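(* Let $m$ be a positive even integer, let $n\geq 5$ be an odd integer, and let $\alpha$ be an atom in $\mathrm{PLat}(n)$. Then there are $\beta,\gamma,\delta\in\mathrm{PLat}(n)$ such that the following two facts hold. (1) $\{\alpha,\beta,\gamma,\delta\}$ is a four-element generating set of $\mathrm{PLat}(n)$. (2) $\mathrm{PLat}(n+m)$ has at least $2^{m-3}\cdot (m-1)!/(3m+3)$ four-element generating sets $\{\alpha',\beta',\gamma',\delta'\}$ such that $\alpha'$, $\beta'$, $\gamma'$, and $\delta'$ extend $\alpha$, $\beta$, $\gamma$, and $\delta$, respectively.
   Context: For a set $A$, $\mathrm{PLat}(A)$ denotes the lattice of all partitions of $A$, ordered by: $\alpha\leq\beta$ iff the equivalence relation determined by $\alpha$ is contained in the equivalence relation determined by $\beta$. For a positive integer $n$, $[n]=\{1,\dots,n\}$ and $\mathrm{PLat}(n):=\mathrm{PLat}([n])$. A subset $X$ of a lattice $L$ is a generating set of $L$ if no proper sublattice of $L$ (closed under binary joins and meets) includes $X$. An atom of $\mathrm{PLat}(A)$ is a partition with exactly one two-element block, all its other blocks being singletons. For a partition $\alpha$ of $A$ and $u\in A$, $u/\alpha$ denotes the block of $\alpha$ containing $u$. For sets $A\subseteq B$, $\alpha\in\mathrm{PLat}(A)$ and $\beta\in\mathrm{PLat}(B)$, we say that $\beta$ extends $\alpha$ if $u/\alpha=A\cap(u/\beta)$ for every $u\in A$. Here this is applied to $[n]\subseteq[n+m]$. "Four-element" means that the four listed partitions are pairwise distinct. *)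

theory Defs
  imports Complex_Main "HOL-Library.Disjoint_Sets" "HOL-Algebra.Lattice"
begin

definition part_rel :: "'a set set \<Rightarrow> ('a \<times> 'a) set" where
  "part_rel P = {(x, y). \<exists>B\<in>P. x \<in> B \<and> y \<in> B}"

definition PLat :: "'a set \<Rightarrow> 'a set set gorder" where
  "PLat A = \<lparr>carrier = {P. partition_on A P}, eq = (=), le = (\<lambda>P Q. part_rel P \<subseteq> part_rel Q)\<rparr>"

definition part_block :: "'a \<Rightarrow> 'a set set \<Rightarrow> 'a set" where
  "part_block u P = part_rel P `` {u}"

lemma part_block_eq:
  assumes "partition_on A P" "B \<in> P" "u \<in> B"
  shows "part_block u P = B"
  using assms unfolding part_block_def part_rel_def partition_on_def
  by (auto simp: pairwise_def disjnt_iff)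

definition part_atom :: "'a set \<Rightarrow> 'a set set \<Rightarrow> bool" where
  "part_atom A P \<longleftrightarrow> partition_on A P \<and>
     (\<exists>B\<in>P. card B = 2 \<and> (\<forall>C\<in>P. C \<noteq> B \<longrightarrow> is_singleton C))"

text \<open>\<open>part_extends A P Q\<close>: the partition \<open>Q\<close> of a superset of \<open>A\<close> extends the partition
  \<open>P\<close> of \<open>A\<close>.\<close>

definition part_extends :: "'a set \<Rightarrow> 'a set set \<Rightarrow> 'a set set \<Rightarrow> bool" where
  "part_extends A P Q \<longleftrightarrow> (\<forall>u\<in>A. part_block u P = A \<inter> part_block u Q)"

definition sublattice :: "('a, 'b) gorder_scheme \<Rightarrow> 'a set \<Rightarrow> bool" where
  "sublattice L S \<longleftrightarrow> S \<subseteq> carrier L \<and> (\<forall>x\<in>S. \<forall>y\<in>S. x \<squnion>\<^bsub>L\<^esub> y \<in> S \<and> x \<sqinter>\<^bsub>L\<^esub> y \<in> S)"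

definition generating_set :: "('a, 'b) gorder_scheme \<Rightarrow> 'a set \<Rightarrow> bool" where
  "generating_set L X \<longleftrightarrow> X \<subseteq> carrier L \<and> \<not> (\<exists>S. sublattice L S \<and> S \<noteq> carrier L \<and> X \<subseteq> S)"

text \<open>The library's \<open>join\<close> and \<open>meet\<close> choose a least upper and a greatest lower bound; that these
  exist in \<open>PLat A\<close> is shown next.\<close>

lemma equiv_part_rel: "partition_on A P \<Longrightarrow> equiv A (part_rel P)"
  unfolding part_rel_def by (rule equiv_partition_on)

lemma part_rel_quotient: "equiv A r \<Longrightarrow> part_rel (A // r) = r"
  unfolding part_rel_def quotient_def equiv_def refl_on_def sym_def trans_def by blast

lemma part_rel_inject:
  "partition_on A P \<Longrightarrow> partition_on A Q \<Longrightarrow> part_rel P = part_rel Q \<Longrightarrow> P = Q"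
  by (metis part_rel_def partition_on_eq_quotient)

lemma lattice_PLat: "lattice (PLat A)"
proof -
  interpret partial_order "PLat A"
  proof
    fix P Q assume "le (PLat A) P Q" "le (PLat A) Q P" "P \<in> carrier (PLat A)" "Q \<in> carrier (PLat A)"
    then have "partition_on A P" "partition_on A Q" "part_rel P = part_rel Q"
      unfolding PLat_def by simp_all
    then have "P = Q" by (rule part_rel_inject)
    then show "eq (PLat A) P Q" by (simp add: PLat_def)
  next
    fix P Q R assume "le (PLat A) P Q" "le (PLat A) Q R"
    then show "le (PLat A) P R" unfolding PLat_def gorder.simps by (rule subset_trans)
  qed (simp_all add: PLat_def)
  show ?thesis
  proof
    fix P Q assume "P \<in> carrier (PLat A)" "Q \<in> carrier (PLat A)"
    then have PQ: "partition_on A P" "partition_on A Q" by (auto simp: PLat_def)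
    note eq = PQ[THEN equiv_part_rel]
    let ?j = "(part_rel P \<union> part_rel Q)\<^sup>+" and ?m = "part_rel P \<inter> part_rel Q"
    have sub: "part_rel P \<subseteq> A \<times> A" "part_rel Q \<subseteq> A \<times> A"
      using eq by (simp_all add: equiv_def)
    have ge_j: "part_rel P \<subseteq> ?j" "part_rel Q \<subseteq> ?j"
      by (intro subsetI r_into_trancl', simp)+
    have j: "equiv A ?j"
    proof (rule equivI)
      show "?j \<subseteq> A \<times> A" using sub by (intro trancl_subset_Sigma) simp
      show "refl_on A ?j" using eq(1) ge_j(1) unfolding equiv_def refl_on_def by blast
      show "sym ?j" using eq by (intro sym_trancl sym_Un) (simp_all add: equiv_def)
      show "trans ?j" by simp
    qed
    have m: "equiv A ?m"
    proof (rule equivI)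
      show "?m \<subseteq> A \<times> A" using sub by blast
      show "refl_on A ?m" using eq by (auto simp: equiv_def refl_on_def)
      show "sym ?m" using eq by (intro sym_Int) (simp_all add: equiv_def)
      show "trans ?m" using eq by (intro trans_Int) (simp_all add: equiv_def)
    qed
    have le_j: "?j \<subseteq> part_rel R"
      if "partition_on A R" "part_rel P \<subseteq> part_rel R" "part_rel Q \<subseteq> part_rel R" for R
    proof -
      have "trans (part_rel R)" using equiv_part_rel[OF that(1)] by (simp add: equiv_def)
      then have "(part_rel R)\<^sup>+ = part_rel R" by (rule trancl_id)
      moreover have "?j \<subseteq> (part_rel R)\<^sup>+"
        using that(2,3) by (intro trancl_mono_subset) simp
      ultimately show ?thesis by simp
    qed
    have le_m: "part_rel R \<subseteq> ?m" if "part_rel R \<subseteq> part_rel P" "part_rel R \<subseteq> part_rel Q" for R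
      using that by simp
    have "least (PLat A) (A // ?j) (Upper (PLat A) {P, Q})"
      using PQ le_j ge_j partition_on_quotient[OF j]
      by (simp add: least_def Upper_def PLat_def part_rel_quotient[OF j])
    then show "\<exists>s. least (PLat A) s (Upper (PLat A) {P, Q})" ..
    have "greatest (PLat A) (A // ?m) (Lower (PLat A) {P, Q})"
      using PQ le_m partition_on_quotient[OF m]
      by (simp add: greatest_def Lower_def PLat_def part_rel_quotient[OF m])
    then show "\<exists>s. greatest (PLat A) s (Lower (PLat A) {P, Q})" ..
  qed
qed

end

(* Number the elements by 0, ..., N - 1, the old ones by 0, ..., n - 1 with the block of the atom at 0 and
   n - 2. Let beta and gamma be the two partitions into consecutive pairs, starting at 0 and at 1, let
   delta be the partition by parity, and let alpha' join 0 with n - 2 and identify the elements of equal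
   parity in an arbitrary set W of new indices. Explicit lattice terms give the atoms {0, 1} and
   {n - 2, n - 1}. Adding alternately beta or gamma and cutting with delta enlarges these to initial and
   final segments, whose meets are the atoms {i, i + 1} with i < n - 1; those with larger i, and then all
   atoms, come from meets of blocks that share exactly two elements.

   The pairs of beta' and gamma' form a path through all indices, so the quadruple determines the
   numbering of the new elements and, if W contains N - 2 and N - 1, also W. This gives m! * 2^(m - 2)
   generating sets, more than needed. *)

theory Submission
  imports Defs "HOL-Combinatorics.Permutations"
begin

section \<open>Kernels, joins and relations with one nontrivial block\<close>

text \<open>With kernels, an upper bound for a lattice term is given by a function that is constant
  on all blocks of the relations being joined.\<close>

definition ker_on :: "'a set \<Rightarrow> ('a \<Rightarrow> 'b) \<Rightarrow> ('a \<times> 'a) set" where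
  "ker_on A f = {(x, y). x \<in> A \<and> y \<in> A \<and> f x = f y}"

lemma ker_on_iff [simp]: "(x, y) \<in> ker_on A f \<longleftrightarrow> x \<in> A \<and> y \<in> A \<and> f x = f y"
  by (simp add: ker_on_def)

lemma equiv_ker_on: "equiv A (ker_on A f)"
  by (rule equivI) (auto simp: ker_on_def refl_on_def sym_def trans_def)

lemma ker_on_subsetI:
  "(\<And>x y. x \<in> A \<Longrightarrow> y \<in> A \<Longrightarrow> f x = f y \<Longrightarrow> g x = g y) \<Longrightarrow> ker_on A f \<subseteq> ker_on A g"
  by auto

text \<open>For equivalence relations on a common set this is their join. \<open>trancl\<close>
  keeps the result inside that set, whereas \<open>rtrancl\<close> would add the diagonal of the
  whole type.\<close>

abbreviation join_rel :: "('a \<times> 'a) set \<Rightarrow> ('a \<times> 'a) set \<Rightarrow> ('a \<times> 'a) set" (infixl "\<squnion>\<^sub>r" 65) where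
  "r \<squnion>\<^sub>r s \<equiv> (r \<union> s)\<^sup>+"

lemma join_rel_least: "r \<subseteq> t \<Longrightarrow> s \<subseteq> t \<Longrightarrow> trans t \<Longrightarrow> r \<squnion>\<^sub>r s \<subseteq> t"
  by (metis Un_least trancl_id trancl_mono_subset)

lemma join_rel_left: "p \<in> r \<Longrightarrow> p \<in> r \<squnion>\<^sub>r s"
  and join_rel_right: "p \<in> s \<Longrightarrow> p \<in> r \<squnion>\<^sub>r s"
  by (cases p; auto)+

text \<open>The set \<open>S\<close> may reach beyond \<open>N\<close>, so final segments can be
  written as \<open>{j..}\<close>.\<close>

definition block_rel :: "nat \<Rightarrow> nat set \<Rightarrow> (nat \<times> nat) set" where
  "block_rel N S = {(x, y). x < N \<and> y < N \<and> (x = y \<or> x \<in> S \<and> y \<in> S)}"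

lemma block_rel_iff [simp]:
  "(x, y) \<in> block_rel N S \<longleftrightarrow> x < N \<and> y < N \<and> (x = y \<or> x \<in> S \<and> y \<in> S)"
  by (simp add: block_rel_def)

lemma block_rel_mono: "S \<subseteq> T \<Longrightarrow> block_rel N S \<subseteq> block_rel N T"
  by auto

lemma trans_block_rel: "trans (block_rel N S)"
  by (auto simp: trans_def)

lemma block_rel_Int: "block_rel N S \<inter> block_rel N T = block_rel N (S \<inter> T)"
  by auto

abbreviation atom_rel :: "nat \<Rightarrow> nat \<Rightarrow> nat \<Rightarrow> (nat \<times> nat) set" where
  "atom_rel N a b \<equiv> block_rel N {a, b}"

section \<open>Sublattices of equivalence relations and their atoms\<close>

text \<open>Joins and meets are concrete set operations here. Later \<open>C\<close> consists of the
  relations whose associated partitions lie in a given sublattice of the partition lattice.\<close>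

locale rel_sublattice =
  fixes N :: nat and C :: "(nat \<times> nat) set set"
  assumes equiv_mem: "r \<in> C \<Longrightarrow> equiv {..<N} r"
    and meet_mem: "r \<in> C \<Longrightarrow> s \<in> C \<Longrightarrow> r \<inter> s \<in> C"
    and join_mem: "r \<in> C \<Longrightarrow> s \<in> C \<Longrightarrow> r \<squnion>\<^sub>r s \<in> C"
begin

abbreviation K :: "(nat \<Rightarrow> nat) \<Rightarrow> (nat \<times> nat) set" where "K \<equiv> ker_on {..<N}"
abbreviation e :: "nat \<Rightarrow> nat \<Rightarrow> (nat \<times> nat) set" where "e \<equiv> atom_rel N"

lemma mem_refl: "r \<in> C \<Longrightarrow> x < N \<Longrightarrow> (x, x) \<in> r"
  using equiv_mem unfolding equiv_def refl_on_def by auto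

lemma mem_sym: "r \<in> C \<Longrightarrow> (x, y) \<in> r \<Longrightarrow> (y, x) \<in> r"
  using equiv_mem unfolding equiv_def by (auto dest: symD)

lemma mem_trans: "r \<in> C \<Longrightarrow> (x, y) \<in> r \<Longrightarrow> (y, z) \<in> r \<Longrightarrow> (x, z) \<in> r"
  using equiv_mem unfolding equiv_def by (auto dest: transD)

lemma join_le_K: "r \<subseteq> K f \<Longrightarrow> s \<subseteq> K f \<Longrightarrow> r \<squnion>\<^sub>r s \<subseteq> K f"
  by (rule join_rel_least) (auto simp: trans_def)

lemma join_le_block: "r \<subseteq> block_rel N S \<Longrightarrow> s \<subseteq> block_rel N S \<Longrightarrow> r \<squnion>\<^sub>r s \<subseteq> block_rel N S"
  by (rule join_rel_least) (auto intro: trans_block_rel)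

text \<open>Reflexivity and symmetry squeeze \<open>r\<close> to the atom. Hence a lattice term only
  has to be bounded from above and shown to contain one pair.\<close>

lemma atom_memI:
  assumes "r \<in> C" "(a, b) \<in> r" "r \<subseteq> e a b"
  shows "e a b \<in> C"
proof -
  have "a < N" "b < N" using assms(2,3) by auto
  then have "e a b \<subseteq> r"
    using mem_refl[OF assms(1)] mem_sym[OF assms(1,2)] assms(2) by auto
  then show ?thesis using assms by auto
qed

text \<open>The paths \<open>a\<close>, \<open>b\<close>, \<open>d\<close> and \<open>a\<close>,
  \<open>c\<close>, \<open>d\<close> give two three-element blocks whose intersection is
  \<open>{a, d}\<close>.\<close>

lemma atom_triangle_mem:
  assumes "e a b \<in> C" "e b d \<in> C" "e a c \<in> C" "e c d \<in> C"
    and "a < N" "b < N" "c < N" "d < N" "b \<noteq> c"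
  shows "e a d \<in> C"
proof (rule atom_memI)
  let ?r = "e a b \<squnion>\<^sub>r e b d" and ?s = "e a c \<squnion>\<^sub>r e c d"
  have r: "?r \<in> C" and s: "?s \<in> C" using assms by (auto intro: join_mem)
  then show "?r \<inter> ?s \<in> C" by (rule meet_mem)
  have "(a, d) \<in> ?r"
    by (rule mem_trans[OF r, of a b]) (use assms in \<open>auto intro: join_rel_left join_rel_right\<close>)
  moreover have "(a, d) \<in> ?s"
    by (rule mem_trans[OF s, of a c]) (use assms in \<open>auto intro: join_rel_left join_rel_right\<close>)
  ultimately show "(a, d) \<in> ?r \<inter> ?s" by blast
  have "?r \<subseteq> block_rel N {a, b, d}" "?s \<subseteq> block_rel N {a, c, d}"
    by (intro join_le_block block_rel_mono; blast)+
  then have "?r \<inter> ?s \<subseteq> block_rel N ({a, b, d} \<inter> {a, c, d})"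
    unfolding block_rel_Int[symmetric] by blast
  also have "\<dots> \<subseteq> e a d" using \<open>b \<noteq> c\<close> by (intro block_rel_mono) auto
  finally show "?r \<inter> ?s \<subseteq> e a d" .
qed

text \<open>Every equivalence relation on a finite set is a join of atoms. Instead of forming a
  finite join, the proof takes a maximal member of \<open>C\<close> below \<open>r\<close>; any
  missing pair could be added by joining its atom.\<close>

lemma all_mem_of_atoms:
  assumes atoms: "\<And>a b. a < N \<Longrightarrow> b < N \<Longrightarrow> a \<noteq> b \<Longrightarrow> e a b \<in> C"
    and "N \<ge> 3" and r: "equiv {..<N} r"
  shows "r \<in> C"
proof -
  \<comment> \<open>Two atoms sharing one index meet in the identity relation, so some member of
    \<open>C\<close> lies below \<open>r\<close>.\<close>
  have "e 0 1 \<inter> e 1 2 \<in> C" using assms by (intro meet_mem atoms) auto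
  moreover have "e 0 1 \<inter> e 1 2 \<subseteq> r"
    using r by (auto simp: equiv_def refl_on_def split: if_splits)
  ultimately have ne: "{t \<in> C. t \<subseteq> r} \<noteq> {}" by blast
  have finr: "finite r" using r by (auto simp: equiv_def intro: finite_subset)
  then have "finite {t \<in> C. t \<subseteq> r}" by (auto intro: finite_subset[of _ "Pow r"])
  then obtain t where t: "t \<in> C" "t \<subseteq> r" and max: "\<And>s. s \<in> C \<Longrightarrow> s \<subseteq> r \<Longrightarrow> t \<subseteq> s \<Longrightarrow> t = s"
    using finite_has_maximal[OF _ ne] by auto
  have "r \<subseteq> t"
  proof (rule subrelI, rule ccontr)
    fix a b assume ab: "(a, b) \<in> r" "(a, b) \<notin> t"
    have lt: "a < N" "b < N" using ab r by (auto simp: equiv_def)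
    then have "a \<noteq> b" using ab mem_refl[OF t(1)] by auto
    then have "t \<squnion>\<^sub>r e a b \<in> C" using t lt by (intro join_mem atoms)
    moreover have "t \<squnion>\<^sub>r e a b \<subseteq> r"
    proof (rule join_rel_least[OF t(2)])
      show "trans r" using r by (simp add: equiv_def)
      show "e a b \<subseteq> r"
        using r ab by (auto simp: equiv_def refl_on_def dest: symD split: if_splits)
    qed
    moreover have "(a, b) \<in> t \<squnion>\<^sub>r e a b"
      by (rule join_rel_right) (use lt in \<open>auto\<close>)
    ultimately show False using max[of "t \<squnion>\<^sub>r e a b"] ab by (metis join_rel_left subsetI)
  qed
  then show ?thesis using t by auto
qed

end

section \<open>The zigzag path and the atoms of neighbouring indices\<close>

text \<open>Only the parity of \<open>i\<close> matters. Allowing every \<open>i\<close> makes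
  \<open>(i, i + 1)\<close> a pair of \<open>pair_rel N i\<close> whenever \<open>i + 1 < N\<close>,
  with no case split on parity.\<close>

definition pair_rel :: "nat \<Rightarrow> nat \<Rightarrow> (nat \<times> nat) set" where
  "pair_rel N i = ker_on {..<N} (\<lambda>x. (x + i mod 2) div 2)"

definition parity_rel :: "nat \<Rightarrow> (nat \<times> nat) set" where
  "parity_rel N = ker_on {..<N} (\<lambda>x. x mod 2)"

lemma pair_rel_iff:
  "(x, y) \<in> pair_rel N i \<longleftrightarrow> x < N \<and> y < N \<and>
     (x = y \<or> x mod 2 = i mod 2 \<and> y = Suc x \<or> y mod 2 = i mod 2 \<and> x = Suc y)"
proof -
  have "X div 2 = Y div 2 \<longleftrightarrow> X = Y \<or> even X \<and> Y = Suc X \<or> even Y \<and> X = Suc Y" for X Y :: nat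
    by (cases "even X"; cases "even Y") (auto elim!: evenE oddE)
  moreover have "even (z + i mod 2) \<longleftrightarrow> z mod 2 = i mod 2" for z
    by (auto simp: mod2_eq_if)
  ultimately show ?thesis by (simp add: pair_rel_def)
qed

lemma parity_rel_iff [simp]: "(x, y) \<in> parity_rel N \<longleftrightarrow> x < N \<and> y < N \<and> x mod 2 = y mod 2"
  by (simp add: parity_rel_def)

text \<open>When \<open>S\<close> is closed under the pairing, the union of
  \<open>block_rel N S\<close> and \<open>pair_rel N i\<close> is already transitive. Paired indices
  differ in parity, so the cut with \<open>parity_rel\<close> discards every pair outside
  \<open>S\<close>.\<close>

lemma join_pair_parity_subset:
  assumes "r \<subseteq> block_rel N S" "\<And>x y. x \<in> S \<Longrightarrow> (x, y) \<in> pair_rel N i \<Longrightarrow> y \<in> S"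
  shows "(r \<squnion>\<^sub>r pair_rel N i) \<inter> parity_rel N \<subseteq> block_rel N S"
proof -
  have "equiv {..<N} (pair_rel N i)" unfolding pair_rel_def by (rule equiv_ker_on)
  then have "sym (pair_rel N i)" and tr: "trans (pair_rel N i)" by (simp_all add: equiv_def)
  then have cl: "(x, y) \<in> pair_rel N i \<Longrightarrow> y \<in> S \<longleftrightarrow> x \<in> S" for x y
    using assms(2) by (meson symD)
  have "trans (block_rel N S \<union> pair_rel N i)"
  proof (rule transI)
    fix x y z
    assume "(x, y) \<in> block_rel N S \<union> pair_rel N i" "(y, z) \<in> block_rel N S \<union> pair_rel N i"
    then show "(x, z) \<in> block_rel N S \<union> pair_rel N i"
      using cl[of x y] cl[of y z] transD[OF tr, of x y z] by (auto simp: pair_rel_iff)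
  qed
  then have "r \<squnion>\<^sub>r pair_rel N i \<subseteq> block_rel N S \<union> pair_rel N i"
    using assms(1) by (intro join_rel_least) auto
  moreover have "pair_rel N i \<inter> parity_rel N \<subseteq> block_rel N S"
    by (auto simp: pair_rel_iff mod_Suc split: if_splits)
  ultimately show ?thesis by blast
qed

locale zigzag_sublattice = rel_sublattice +
  assumes pair_mem: "pair_rel N i \<in> C"
    and parity_mem: "parity_rel N \<in> C"
begin

abbreviation L where "L \<equiv> pair_rel N"
abbreviation par where "par \<equiv> parity_rel N"

text \<open>Joining \<open>L (i + 1)\<close> links \<open>i + 2\<close> to \<open>i\<close>, the
  parity cut keeps this link but removes the pairs outside the segment, and joining \<open>p\<close>
  again restores \<open>(i + 1, i + 2)\<close>. Only the last pair and the support are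
  tracked.\<close>

lemma prefix_mem:
  assumes "e 0 1 \<in> C" "Suc i < N"
  shows "\<exists>p\<in>C. (i, Suc i) \<in> p \<and> p \<subseteq> block_rel N {..Suc i}"
  using assms(2)
proof (induction i)
  case 0
  show ?case by (rule bexI[OF _ assms(1)]) (use 0 in auto)
next
  case (Suc i)
  then obtain p where p: "p \<in> C" "(i, Suc i) \<in> p" "p \<subseteq> block_rel N {..Suc i}"
    by auto
  let ?j = "p \<squnion>\<^sub>r L (Suc i)"
  let ?q = "(?j \<inter> par) \<squnion>\<^sub>r p"
  have j: "?j \<in> C" and q: "?q \<in> C" using p by (auto intro: join_mem meet_mem pair_mem parity_mem)
  have "(Suc i, Suc (Suc i)) \<in> L (Suc i)"
    using Suc.prems by (simp add: pair_rel_iff)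
  then have "(i, Suc (Suc i)) \<in> ?j"
    using mem_trans[OF j join_rel_left[OF p(2)] join_rel_right] by blast
  then have "(i, Suc (Suc i)) \<in> ?j \<inter> par"
    using Suc.prems by simp
  then have "(Suc i, Suc (Suc i)) \<in> ?q"
    using mem_trans[OF q mem_sym[OF q join_rel_right[OF p(2)]] join_rel_left] by blast
  moreover have "?q \<subseteq> block_rel N {..Suc (Suc i)}"
  proof (rule join_le_block)
    show p': "p \<subseteq> block_rel N {..Suc (Suc i)}"
      using p(3) by (rule subset_trans) (rule block_rel_mono, auto)
    show "?j \<inter> par \<subseteq> block_rel N {..Suc (Suc i)}"
    proof (rule join_pair_parity_subset[OF p'])
      show "y \<in> {..Suc (Suc i)}" if "x \<in> {..Suc (Suc i)}" "(x, y) \<in> L (Suc i)" for x y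
        using that
          by (cases "x = Suc (Suc i)") (auto simp: pair_rel_iff mod_Suc split: if_splits)
    qed
  qed
  ultimately show ?case using q by blast
qed

text \<open>The mirror image of \<open>prefix_mem\<close>, descending from the atom at
  \<open>m\<close>. The relation can spread above \<open>m + 1\<close> on the way, so the bound is
  the full final segment \<open>{j..}\<close>.\<close>

lemma suffix_mem:
  assumes "e m (Suc m) \<in> C" "j \<le> m" "Suc m < N"
  shows "\<exists>q\<in>C. (j, Suc j) \<in> q \<and> q \<subseteq> block_rel N {j..}"
  using assms(2)
proof (induction j rule: inc_induct)
  case base
  show ?case by (rule bexI[OF _ assms(1)]) (use assms in auto)
next
  case (step j)
  then obtain p where p: "p \<in> C" "(Suc j, Suc (Suc j)) \<in> p" "p \<subseteq> block_rel N {Suc j..}"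
    by auto
  have jN: "Suc (Suc j) < N" using step assms by simp
  let ?j = "p \<squnion>\<^sub>r L j"
  let ?q = "(?j \<inter> par) \<squnion>\<^sub>r p"
  have j: "?j \<in> C" and q: "?q \<in> C" using p by (auto intro: join_mem meet_mem pair_mem parity_mem)
  have "(j, Suc j) \<in> L j"
    using jN by (simp add: pair_rel_iff)
  then have "(j, Suc (Suc j)) \<in> ?j"
    using mem_trans[OF j join_rel_right join_rel_left[OF p(2)]] by blast
  then have "(j, Suc (Suc j)) \<in> ?j \<inter> par"
    using jN by simp
  then have "(j, Suc j) \<in> ?q"
    using mem_trans[OF q join_rel_left mem_sym[OF q join_rel_right[OF p(2)]]] by blast
  moreover have "?q \<subseteq> block_rel N {j..}"
  proof (rule join_le_block)
    show p': "p \<subseteq> block_rel N {j..}"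
      using p(3) by (rule subset_trans) (rule block_rel_mono, auto)
    show "?j \<inter> par \<subseteq> block_rel N {j..}"
    proof (rule join_pair_parity_subset[OF p'])
      show "y \<in> {j..}" if "x \<in> {j..}" "(x, y) \<in> L j" for x y
        using that
          by (cases "x = j") (auto simp: pair_rel_iff mod_Suc split: if_splits)
    qed
  qed
  ultimately show ?case using q by blast
qed

lemma inner_atom_mem:
  assumes "e 0 1 \<in> C" "e m (Suc m) \<in> C" "Suc m < N" "i \<le> m"
  shows "e i (Suc i) \<in> C"
proof -
  have "Suc i < N" using assms by simp
  then obtain p q where
    p: "p \<in> C" "(i, Suc i) \<in> p" "p \<subseteq> block_rel N {..Suc i}" and
    q: "q \<in> C" "(i, Suc i) \<in> q" "q \<subseteq> block_rel N {i..}"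
    using prefix_mem[OF assms(1)] suffix_mem[OF assms(2,4,3)] by blast
  have "{..Suc i} \<inter> {i..} = {i, Suc i}" by auto
  then have "p \<inter> q \<subseteq> e i (Suc i)"
    using p(3) q(3) by (metis Int_mono block_rel_Int)
  then show ?thesis
    using p q by (intro atom_memI[of "p \<inter> q"]) (auto intro: meet_mem)
qed

text \<open>Equal parity puts both \<open>(w, w + 1)\<close> and \<open>(i, i + 1)\<close> into
  \<open>L i\<close>, so the atom of \<open>w\<close> and \<open>i\<close> connects all four
  indices. The parity cut removes the other pairs but keeps \<open>(w + 1, i + 1)\<close>, and the
  two given atoms reconnect the block.\<close>

lemma four_block_mem:
  assumes "e w i \<in> C" "e w (Suc w) \<in> C" "w mod 2 = i mod 2" "Suc w < i" "Suc i < N"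
  shows "\<exists>r\<in>C. (i, Suc i) \<in> r \<and> r \<subseteq> block_rel N {w, Suc w, i, Suc i}"
proof -
  let ?j = "e w i \<squnion>\<^sub>r L i"
  let ?q = "(?j \<inter> par) \<squnion>\<^sub>r e w i"
  let ?r = "?q \<squnion>\<^sub>r e w (Suc w)"
  let ?S = "{w, Suc w, i, Suc i}"
  have j: "?j \<in> C" and q: "?q \<in> C" and r: "?r \<in> C"
    using assms by (auto intro!: join_mem meet_mem pair_mem parity_mem)
  have "(Suc w, w) \<in> L i" "(i, Suc i) \<in> L i"
    using assms by (simp_all add: pair_rel_iff)
  moreover have "(w, i) \<in> e w i" using assms by auto
  ultimately have "(Suc w, Suc i) \<in> ?j"
    using mem_trans[OF j mem_trans[OF j join_rel_right join_rel_left] join_rel_right] by blast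
  moreover have "(Suc w, Suc i) \<in> par"
    using assms by (simp add: mod_Suc)
  ultimately have "(Suc w, Suc i) \<in> ?r" by (intro join_rel_left) blast
  moreover have "(w, Suc w) \<in> ?r"
    by (rule join_rel_right) (use assms in auto)
  moreover have "(i, w) \<in> ?r"
    by (rule join_rel_left, rule join_rel_right) (use assms in auto)
  ultimately have "(i, Suc i) \<in> ?r" using mem_trans[OF r] by blast
  moreover have "?r \<subseteq> block_rel N ?S"
  proof (intro join_le_block)
    show "e w i \<subseteq> block_rel N ?S" "e w (Suc w) \<subseteq> block_rel N ?S"
      by (rule block_rel_mono, blast)+
    then show "?j \<inter> par \<subseteq> block_rel N ?S"
    proof (intro join_pair_parity_subset)
      \<comment> \<open>Abstracting parity to a predicate that flips under \<open>Suc\<close> spares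
        the automation all modular arithmetic.\<close>
      define P where "P z \<longleftrightarrow> z mod 2 = i mod 2" for z
      have P: "P w" "P i" "\<And>z. P (Suc z) \<longleftrightarrow> \<not> P z"
        using assms(3) by (auto simp: P_def mod2_eq_if)
      show "y \<in> ?S" if "x \<in> ?S" "(x, y) \<in> L i" for x y
        using that P unfolding pair_rel_iff P_def[symmetric] by auto
    qed
  qed
  ultimately show ?thesis using r by blast
qed

text \<open>For \<open>i \<ge> 4\<close> there are two disjoint pairs \<open>{w, w + 1}\<close> below \<open>i\<close> in the zigzag relation
  containing \<open>(i, i + 1)\<close>, so the blocks \<open>{w, w + 1, i, i + 1}\<close> they give meet in \<open>{i, i + 1}\<close>.\<close>

lemma outer_atom_mem:
  assumes "\<And>a b. a \<le> i \<Longrightarrow> b \<le> i \<Longrightarrow> a \<noteq> b \<Longrightarrow> e a b \<in> C" "4 \<le> i" "Suc i < N"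
  shows "e i (Suc i) \<in> C"
proof -
  \<comment> \<open>The least index with the parity of \<open>i\<close>; the second pair starts at
    \<open>w + 2\<close>. If \<open>w = 1\<close>, then \<open>i\<close> is odd and at least 5, so
    \<open>w + 3 < i\<close> holds in both cases.\<close>
  define w where "w = i mod 2"
  have w: "w mod 2 = i mod 2" "Suc (Suc w) mod 2 = i mod 2"
    by (simp_all add: w_def)
  have "w < 2" "i = 4 \<Longrightarrow> w = 0"
    by (simp_all add: w_def)
  then have w3: "Suc (Suc (Suc w)) < i"
    using assms(2) by (cases "i = 4") auto
  have mem: "e w i \<in> C" "e w (Suc w) \<in> C" "e (Suc (Suc w)) i \<in> C"
      "e (Suc (Suc w)) (Suc (Suc (Suc w))) \<in> C"
    using w3 by (intro assms(1); simp)+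
  obtain r where r: "r \<in> C" "(i, Suc i) \<in> r" "r \<subseteq> block_rel N {w, Suc w, i, Suc i}"
    using four_block_mem[OF mem(1,2) w(1) _ assms(3)] w3 by auto
  obtain s where s: "s \<in> C" "(i, Suc i) \<in> s"
      "s \<subseteq> block_rel N {Suc (Suc w), Suc (Suc (Suc w)), i, Suc i}"
    using four_block_mem[OF mem(3,4) w(2) w3 assms(3)] by auto
  have "{w, Suc w, i, Suc i} \<inter> {Suc (Suc w), Suc (Suc (Suc w)), i, Suc i} = {i, Suc i}"
    using w3 by auto
  then have "r \<inter> s \<subseteq> e i (Suc i)"
    using r(3) s(3) by (metis Int_mono block_rel_Int)
  then show ?thesis
    using r s by (intro atom_memI[of "r \<inter> s"]) (auto intro: meet_mem)
qed

text \<open>The new index \<open>i + 1\<close> is first joined to \<open>i - 1\<close>, by cutting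
  the block \<open>{i - 1, i, i + 1}\<close> with parity. Every smaller index then reaches it along
  two paths, through \<open>i\<close> and through \<open>i - 1\<close>.\<close>

lemma atoms_below_Suc:
  assumes "\<And>a b. a \<le> i \<Longrightarrow> b \<le> i \<Longrightarrow> a \<noteq> b \<Longrightarrow> e a b \<in> C" "e i (Suc i) \<in> C" "Suc i < N"
    and ab: "a \<le> Suc i" "b \<le> Suc i" "a \<noteq> b"
  shows "e a b \<in> C"
proof -
  have skip: "e j (Suc i) \<in> C" if i: "i = Suc j" for j
  proof (rule atom_memI)
    let ?j = "e j i \<squnion>\<^sub>r e i (Suc i)"
    have j: "?j \<in> C" using assms(1)[of j i] assms(2) that by (auto intro: join_mem)
    then show "?j \<inter> par \<in> C" by (intro meet_mem parity_mem)
    have "(j, Suc i) \<in> ?j"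
      by (rule mem_trans[OF j, of _ i])
        (use assms(3) i in \<open>auto intro: join_rel_left join_rel_right\<close>)
    then show "(j, Suc i) \<in> ?j \<inter> par" using assms(3) i by simp
    have "?j \<subseteq> block_rel N {j, i, Suc i}"
      by (intro join_le_block block_rel_mono) auto
    moreover have "i mod 2 \<noteq> j mod 2" "Suc i mod 2 \<noteq> i mod 2"
      using i by (simp_all add: mod2_eq_if)
    then have "block_rel N {j, i, Suc i} \<inter> par \<subseteq> e j (Suc i)"
      by auto
    ultimately show "?j \<inter> par \<subseteq> e j (Suc i)" by blast
  qed
  have "e c (Suc i) \<in> C" if "c \<le> i" for c
  proof -
    consider "c = i" | "Suc c = i" | "Suc c < i"
      using \<open>c \<le> i\<close> by (meson le_neq_implies_less Suc_lessI)
    then show ?thesis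
    proof cases
      case 3
      then show ?thesis
        using assms(1)[of c i] assms(1)[of c "i - 1"] assms(2,3) skip[of "i - 1"]
        by (intro atom_triangle_mem[of c i "Suc i" "i - 1"]) auto
    qed (use assms(2) skip in auto)
  qed
  then show ?thesis using assms(1) ab by (metis insert_commute le_Suc_eq)
qed

text \<open>Induction on the largest index used: neighbouring atoms come from segments up to
  \<open>m\<close> and from four-element blocks beyond it. The latter require \<open>4 <= i\<close>,
  which \<open>3 <= m\<close> guarantees.\<close>

lemma all_mem_of_end_atoms:
  assumes "e 0 1 \<in> C" "e m (Suc m) \<in> C" "3 \<le> m" "Suc m < N" "equiv {..<N} r"
  shows "r \<in> C"
proof (rule all_mem_of_atoms)
  have below: "e a b \<in> C" if "i < N" "a \<le> i" "b \<le> i" "a \<noteq> b" for i a b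
    using that
  proof (induction i arbitrary: a b)
    case (Suc i)
    then have IH: "e a b \<in> C" if "a \<le> i" "b \<le> i" "a \<noteq> b" for a b using that by simp
    have "e i (Suc i) \<in> C"
    proof (cases "i \<le> m")
      case True
      then show ?thesis using inner_atom_mem assms by blast
    next
      case False
      then show ?thesis using outer_atom_mem IH assms Suc.prems by auto
    qed
    then show ?case using atoms_below_Suc IH Suc.prems by blast
  qed simp
  show "e a b \<in> C" if "a < N" "b < N" "a \<noteq> b" for a b
    using below[of "max a b" a b] that by auto
qed (use assms in auto)

end

section \<open>The first generator and the two end atoms\<close>

text \<open>The value 0 marks the block of the atom, 1 and 2 the parity classes in \<open>W\<close>,
  and values from 3 on the singletons, so the three kinds never collide.\<close>

definition corner_rel :: "nat \<Rightarrow> nat \<Rightarrow> nat set \<Rightarrow> (nat \<times> nat) set" where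
  "corner_rel N l W = ker_on {..<N}
     (\<lambda>x. if x = 0 \<or> x = 2 * l + 1 then 0 else if x \<in> W then 1 + x mod 2 else x + 3)"

lemma corner_rel_iff:
  assumes "W \<subseteq> {2 * l + 3..<N}"
  shows "(x, y) \<in> corner_rel N l W \<longleftrightarrow> x < N \<and> y < N \<and>
    (x = y \<or> x \<in> {0, 2 * l + 1} \<and> y \<in> {0, 2 * l + 1} \<or> x \<in> W \<and> y \<in> W \<and> x mod 2 = y mod 2)"
proof -
  have "0 \<notin> W" "2 * l + 1 \<notin> W" using assms by auto
  moreover have "z mod 2 < 2" for z :: nat by simp
  ultimately show ?thesis by (auto simp: corner_rel_def mod2_eq_if)
qed

lemma parity_rel_iff_even: "(x, y) \<in> parity_rel N \<longleftrightarrow> x < N \<and> y < N \<and> (even x \<longleftrightarrow> even y)"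
  by (auto simp: mod2_eq_if)

lemma pair_rel_subset_ker:
  assumes "\<And>t. Suc (2 * t + c) < N \<Longrightarrow> f (2 * t + c) = f (Suc (2 * t + c))" "c < 2"
  shows "pair_rel N c \<subseteq> ker_on {..<N} f"
proof -
  have "f x = f (Suc x)" if "x mod 2 = c mod 2" "Suc x < N" for x
  proof -
    have "x = 2 * (x div 2) + c" using that(1) assms(2) by (metis mod_less mult_div_mod_eq)
    then show ?thesis using assms(1)[of "x div 2"] that(2) by metis
  qed
  then show ?thesis by (auto simp: pair_rel_iff)
qed

text \<open>Only an upper bound, the kernel of an explicit function, and one pair are computed for each of
  the lattice terms \<open>A1, \<dots>, A5\<close>; their exact values, which depend on \<open>W\<close>, are not needed.\<close>

lemma (in zigzag_sublattice) end_atoms_mem: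
  assumes al: "corner_rel N l W \<in> C" and l: "1 \<le> l" and W: "W \<subseteq> {2 * l + 3..<N}" and N: "2 * l + 2 < N"
  shows "e 0 1 \<in> C" and "e (2 * l + 1) (2 * l + 2) \<in> C"
proof -
  let ?al = "corner_rel N l W"
  \<comment> \<open>Without new indices, \<open>?A1\<close> is the atom of 0 and
    \<open>2 * l + 2\<close>, and \<open>?A2\<close> that of \<open>2 * l + 1\<close> and
    \<open>2 * l + 2\<close>. \<open>?A3\<close> joins 0 with \<open>2 * l\<close> and 1 with
    \<open>2 * l + 1\<close>; \<open>?A4\<close> adds \<open>2 * l + 2\<close> to the latter block.
    Meeting with \<open>?J5\<close> leaves in \<open>?A5\<close> the atom of 1 and
    \<open>2 * l + 2\<close>, so \<open>?J6\<close> connects 0 and 1 through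
    \<open>2 * l + 2\<close>.\<close>
  let ?J1 = "?al \<squnion>\<^sub>r L 1"
  let ?A1 = "?J1 \<inter> par"
  let ?J2 = "?al \<squnion>\<^sub>r ?A1"
  let ?A2 = "?J2 \<inter> L 1"
  let ?J3 = "?al \<squnion>\<^sub>r L 0"
  let ?A3 = "?J3 \<inter> par"
  let ?A4 = "?A3 \<squnion>\<^sub>r ?A2"
  let ?J5 = "?A1 \<squnion>\<^sub>r L 0"
  let ?A5 = "?A4 \<inter> ?J5"
  let ?J6 = "?A5 \<squnion>\<^sub>r ?A1"
  have mem: "?J1 \<in> C" "?A1 \<in> C" "?J2 \<in> C" "?A2 \<in> C" "?J3 \<in> C" "?A3 \<in> C" "?A4 \<in> C"
      "?J5 \<in> C" "?A5 \<in> C" "?J6 \<in> C"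
    using al by (intro join_mem meet_mem pair_mem parity_mem; simp)+
  \<comment> \<open>Merging all indices from \<open>2 * l + 3\<close> on by parity makes the bounds
    uniform in \<open>W\<close>.\<close>
  have le_al: "?al \<subseteq> K f"
    if "f 0 = f (2 * l + 1)" "\<And>x y. 2 * l + 3 \<le> x \<Longrightarrow> 2 * l + 3 \<le> y \<Longrightarrow> even x = even y \<Longrightarrow> f x = f y"
    for f :: "nat \<Rightarrow> nat"
  proof (rule subrelI)
    fix x y assume "(x, y) \<in> ?al"
    then have lt: "x < N" "y < N"
      and "x = y \<or> x \<in> {0, 2 * l + 1} \<and> y \<in> {0, 2 * l + 1} \<or> x \<in> W \<and> y \<in> W \<and> even x = even y"
      by (auto simp: corner_rel_iff[OF W] even_iff_mod_2_eq_zero)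
    moreover have "2 * l + 3 \<le> z" if "z \<in> W" for z using W that by auto
    ultimately have "f x = f y" using that(1) that(2)[of x y] by auto
    then show "(x, y) \<in> K f" using lt by simp
  qed
  have div2: "x = y" if "x div 2 = y div 2" "even x = even y" for x y :: nat
    using that by (metis div_mult_mod_eq mod2_eq_if)
  have Suc_div2: "x = y" if "Suc x div 2 = Suc y div 2" "even x = even y" for x y :: nat
    using div2[of "Suc x" "Suc y"] that by simp
  \<comment> \<open>Values from \<open>N\<close> on exceed every index, so they serve as fresh
    labels for merged blocks here and in the later bounds.\<close>
  let ?B1 = "\<lambda>x. if x = 0 \<or> x = 2 * l + 2 then N
    else if 2 * l + 3 \<le> x then if even x then N + 1 else N + 2 else x"
  have A1: "?A1 \<subseteq> K ?B1"
  proof -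
    let ?f = "\<lambda>x. if x = 0 \<or> x = 2 * l + 1 \<or> x = 2 * l + 2 then N
      else if 2 * l + 3 \<le> x then N + 1 else (x + 1) div 2"
    have "?J1 \<subseteq> K ?f"
      by (intro join_le_K le_al pair_rel_subset_ker) (auto, arith)
    moreover have "K ?f \<inter> par \<subseteq> K ?B1"
      by (rule subrelI) (auto simp: parity_rel_iff_even dest: Suc_div2 split: if_splits simp del: parity_rel_iff)
    ultimately show ?thesis by blast
  qed
  have A2: "?A2 \<subseteq> e (2 * l + 1) (2 * l + 2)"
  proof -
    let ?f = "\<lambda>x. if x = 0 \<or> x = 2 * l + 1 \<or> x = 2 * l + 2 then N
      else if 2 * l + 3 \<le> x then if even x then N + 1 else N + 2 else x"
    have "K ?B1 \<subseteq> K ?f" by (rule ker_on_subsetI) (auto split: if_splits)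
    then have "?J2 \<subseteq> K ?f"
      using A1 by (intro join_le_K le_al) auto
    moreover have "K ?f \<inter> L 1 \<subseteq> e (2 * l + 1) (2 * l + 2)"
      by (auto simp: pair_rel_iff split: if_splits)
    ultimately show ?thesis by blast
  qed
  let ?B3 = "\<lambda>x. if x = 0 \<or> x = 2 * l then N else if x = 1 \<or> x = 2 * l + 1 then N + 1
    else if 2 * l + 2 \<le> x then if even x then N + 2 else N + 3 else x"
  have A3: "?A3 \<subseteq> K ?B3"
  proof -
    let ?f = "\<lambda>x. if x = 0 \<or> x = 1 \<or> x = 2 * l \<or> x = 2 * l + 1 then N
      else if 2 * l + 2 \<le> x then N + 1 else x div 2"
    have "?J3 \<subseteq> K ?f"
      by (intro join_le_K le_al pair_rel_subset_ker) (auto, arith)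
    moreover have "K ?f \<inter> par \<subseteq> K ?B3"
      by (rule subrelI) (auto simp: parity_rel_iff_even dest: div2 split: if_splits simp del: parity_rel_iff)
    ultimately show ?thesis by blast
  qed
  let ?B4 = "\<lambda>x. if x = 0 \<or> x = 2 * l then N
    else if x = 1 \<or> x = 2 * l + 1 \<or> 2 * l + 2 \<le> x \<and> even x then N + 1
    else if 2 * l + 2 \<le> x then N + 2 else x"
  have A4: "?A4 \<subseteq> K ?B4"
  proof (rule join_le_K)
    show "?A3 \<subseteq> K ?B4"
      using A3 by (rule subset_trans) (rule ker_on_subsetI, auto split: if_splits)
    show "?A2 \<subseteq> K ?B4"
      using A2 by (rule subset_trans) auto
  qed
  have J5: "?J5 \<subseteq> K (\<lambda>x. if x = 0 \<or> x = 1 \<or> 2 * l + 2 \<le> x then N else x div 2)"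
  proof (rule join_le_K)
    show "?A1 \<subseteq> K (\<lambda>x. if x = 0 \<or> x = 1 \<or> 2 * l + 2 \<le> x then N else x div 2)"
      using A1 by (rule subset_trans) (rule ker_on_subsetI, auto split: if_splits)
    show "L 0 \<subseteq> K (\<lambda>x. if x = 0 \<or> x = 1 \<or> 2 * l + 2 \<le> x then N else x div 2)"
      by (rule pair_rel_subset_ker) (auto, arith)
  qed
  \<comment> \<open>In the bound for \<open>?J5\<close> the indices \<open>2 * l\<close> and
    \<open>2 * l + 1\<close> have the value \<open>l\<close>, unlike 0 and 1. The meet therefore
    removes them from the blocks of \<open>?A4\<close> and isolates 0.\<close>
  have A5: "?A5 \<subseteq> K (\<lambda>x. if x = 1 \<or> 2 * l + 2 \<le> x \<and> even x then N + 1
    else if 2 * l + 2 \<le> x then N + 2 else x)"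
    using A4 J5 l by (intro subset_trans[OF Int_mono[OF A4 J5]] subrelI) (auto split: if_splits)
  have A6: "?J6 \<inter> L 0 \<subseteq> e 0 1"
  proof -
    let ?f = "\<lambda>x. if x = 0 \<or> x = 1 \<or> 2 * l + 2 \<le> x \<and> even x then N + 1
      else if 2 * l + 2 \<le> x then N + 2 else x"
    have "?J6 \<subseteq> K ?f"
    proof (rule join_le_K)
      show "?A5 \<subseteq> K ?f"
        using A5 by (rule subset_trans) (rule ker_on_subsetI, auto split: if_splits)
      show "?A1 \<subseteq> K ?f"
        using A1 by (rule subset_trans) (rule ker_on_subsetI, auto split: if_splits)
    qed
    moreover have "K ?f \<inter> L 0 \<subseteq> e 0 1"
      by (auto simp: pair_rel_iff split: if_splits)
    ultimately show ?thesis by blast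
  qed
  have al0: "(0, 2 * l + 1) \<in> ?al" using N by (simp add: corner_rel_def)
  have ga: "(2 * l + 1, 2 * l + 2) \<in> L 1" using N by (simp add: pair_rel_iff)
  have be: "(0, 1) \<in> L 0" using N by (simp add: pair_rel_iff)
  have be': "(2 * l, 2 * l + 1) \<in> L 0" using N by (simp add: pair_rel_iff)
  have A1': "(0, 2 * l + 2) \<in> ?A1"
    using mem_trans[OF mem(1) join_rel_left[OF al0] join_rel_right[OF ga]] N by simp
  then have "(2 * l + 1, 2 * l + 2) \<in> ?J2"
    using mem_trans[OF mem(3) mem_sym[OF mem(3) join_rel_left[OF al0]] join_rel_right] by blast
  then have A2': "(2 * l + 1, 2 * l + 2) \<in> ?A2" using ga by blast
  show "e (2 * l + 1) (2 * l + 2) \<in> C" by (rule atom_memI[OF mem(4) A2' A2])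
  have "(1, 2 * l + 1) \<in> ?J3"
    using mem_trans[OF mem(5) mem_sym[OF mem(5) join_rel_right[OF be]] join_rel_left[OF al0]] .
  then have "(1, 2 * l + 1) \<in> ?A3" using N by (simp add: mod2_eq_if)
  then have "(1, 2 * l + 2) \<in> ?A4"
    using mem_trans[OF mem(7) join_rel_left join_rel_right[OF A2']] by blast
  moreover have "(1, 2 * l + 2) \<in> ?J5"
    using mem_trans[OF mem(8) mem_sym[OF mem(8) join_rel_right[OF be]] join_rel_left[OF A1']] .
  ultimately have "(1, 2 * l + 2) \<in> ?A5" by blast
  then have "(0, 1) \<in> ?J6"
    using mem_trans[OF mem(10) join_rel_right[OF A1'] mem_sym[OF mem(10) join_rel_left]] by blast
  then have "(0, 1) \<in> ?J6 \<inter> L 0" using be by blast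
  then show "e 0 1 \<in> C" using A6 mem(10) by (intro atom_memI[of "?J6 \<inter> L 0"] meet_mem pair_mem)
qed

section \<open>Transfer to the lattice of partitions\<close>

lemma equiv_join_rel:
  assumes "equiv A r" "equiv A s"
  shows "equiv A (r \<squnion>\<^sub>r s)"
proof (rule equivI)
  have "r \<union> s \<subseteq> A \<times> A" using assms by (auto simp: equiv_def)
  then show "r \<squnion>\<^sub>r s \<subseteq> A \<times> A" by (rule trancl_subset_Sigma)
  show "refl_on A (r \<squnion>\<^sub>r s)"
    using assms unfolding equiv_def refl_on_def by (auto intro: join_rel_left)
  show "sym (r \<squnion>\<^sub>r s)" using assms by (intro sym_trancl sym_Un) (simp_all add: equiv_def)
qed simp

lemma equiv_Int: "equiv A r \<Longrightarrow> equiv A s \<Longrightarrow> equiv A (r \<inter> s)"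
  by (rule equivI) (auto simp: equiv_def refl_on_def intro: sym_Int trans_Int)

lemma PLat_simps:
  "P \<in> carrier (PLat A) \<longleftrightarrow> partition_on A P"
  "le (PLat A) P Q \<longleftrightarrow> part_rel P \<subseteq> part_rel Q"
  by (simp_all add: PLat_def)

text \<open>The library's join is a chosen least upper bound; comparing it in both directions with
  the transitive closure makes it concrete.\<close>

lemma PLat_join:
  assumes "partition_on A P" "partition_on A Q"
  shows "P \<squnion>\<^bsub>PLat A\<^esub> Q = A // (part_rel P \<squnion>\<^sub>r part_rel Q)"
proof -
  interpret lattice "PLat A" by (rule lattice_PLat)
  let ?t = "part_rel P \<squnion>\<^sub>r part_rel Q" and ?J = "P \<squnion>\<^bsub>PLat A\<^esub> Q"
  have t: "equiv A ?t" using assms by (intro equiv_join_rel equiv_part_rel)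
  have PQ: "P \<in> carrier (PLat A)" "Q \<in> carrier (PLat A)" using assms by (simp_all add: PLat_simps)
  have J: "partition_on A ?J" using join_closed[OF PQ] by (simp add: PLat_simps)
  have T: "partition_on A (A // ?t)" using t by (rule partition_on_quotient)
  have "part_rel P \<subseteq> part_rel ?J" "part_rel Q \<subseteq> part_rel ?J"
    using join_left[OF PQ] join_right[OF PQ] by (simp_all add: PLat_simps)
  then have "?t \<subseteq> part_rel ?J"
    using equiv_part_rel[OF J] by (intro join_rel_least) (simp_all add: equiv_def)
  moreover have "le (PLat A) ?J (A // ?t)"
    using T by (intro join_le PQ) (auto simp: PLat_simps part_rel_quotient[OF t] join_rel_left join_rel_right)
  ultimately have "part_rel ?J = part_rel (A // ?t)"
    by (simp add: PLat_simps part_rel_quotient[OF t])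
  then show ?thesis by (rule part_rel_inject[OF J T])
qed

lemma PLat_meet:
  assumes "partition_on A P" "partition_on A Q"
  shows "P \<sqinter>\<^bsub>PLat A\<^esub> Q = A // (part_rel P \<inter> part_rel Q)"
proof -
  interpret lattice "PLat A" by (rule lattice_PLat)
  let ?t = "part_rel P \<inter> part_rel Q" and ?M = "P \<sqinter>\<^bsub>PLat A\<^esub> Q"
  have t: "equiv A ?t" using assms by (intro equiv_Int equiv_part_rel)
  have PQ: "P \<in> carrier (PLat A)" "Q \<in> carrier (PLat A)" using assms by (simp_all add: PLat_simps)
  have M: "partition_on A ?M" using meet_closed[OF PQ] by (simp add: PLat_simps)
  have T: "partition_on A (A // ?t)" using t by (rule partition_on_quotient)
  have "part_rel ?M \<subseteq> ?t"
    using meet_left[OF PQ] meet_right[OF PQ] by (simp add: PLat_simps)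
  moreover have "le (PLat A) (A // ?t) ?M"
    using T by (intro meet_le PQ) (auto simp: PLat_simps part_rel_quotient[OF t])
  ultimately have "part_rel ?M = part_rel (A // ?t)"
    unfolding PLat_simps part_rel_quotient[OF t] by (rule subset_antisym)
  then show ?thesis by (rule part_rel_inject[OF M T])
qed

definition pull_rel :: "'a set \<Rightarrow> ('a \<Rightarrow> 'b) \<Rightarrow> ('b \<times> 'b) set \<Rightarrow> ('a \<times> 'a) set" where
  "pull_rel A g r = {(x, y). x \<in> A \<and> y \<in> A \<and> (g x, g y) \<in> r}"

lemma pull_rel_iff [simp]: "(x, y) \<in> pull_rel A g r \<longleftrightarrow> x \<in> A \<and> y \<in> A \<and> (g x, g y) \<in> r"
  by (simp add: pull_rel_def)

lemma equiv_pull_rel: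
  assumes "g ` A \<subseteq> B" "equiv B r"
  shows "equiv A (pull_rel A g r)"
proof (rule equivI)
  show "refl_on A (pull_rel A g r)"
    using assms by (auto simp: refl_on_def equiv_def)
  show "sym (pull_rel A g r)"
    using assms(2) by (auto simp: equiv_def sym_def)
  show "trans (pull_rel A g r)"
    using assms(2) by (auto simp: equiv_def intro!: transI dest: transD)
qed auto

text \<open>A chain witnessing the join on \<open>B\<close> may pass through arbitrary points of
  \<open>B\<close>; surjectivity of \<open>g\<close> lifts each of them to \<open>A\<close>.\<close>

lemma pull_rel_join:
  assumes g: "bij_betw g A B" and eq: "equiv B r" "equiv B s"
  shows "pull_rel A g (r \<squnion>\<^sub>r s) = pull_rel A g r \<squnion>\<^sub>r pull_rel A g s"
proof
  have "g ` A \<subseteq> B" using g by (simp add: bij_betw_def)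
  then have "equiv A (pull_rel A g (r \<squnion>\<^sub>r s))"
    using eq by (intro equiv_pull_rel equiv_join_rel)
  then show "pull_rel A g r \<squnion>\<^sub>r pull_rel A g s \<subseteq> pull_rel A g (r \<squnion>\<^sub>r s)"
    by (intro join_rel_least) (auto intro: join_rel_left join_rel_right simp: equiv_def)
  define f where "f = the_inv_into A g"
  have f: "f b \<in> A" "g (f b) = b" if "b \<in> B" for b
    using g that unfolding f_def bij_betw_def
    by (auto intro: the_inv_into_into f_the_inv_into_f)
  have fg: "f (g x) = x" if "x \<in> A" for x
    using g that unfolding f_def bij_betw_def by (auto intro: the_inv_into_f_f)
  have sub: "r \<union> s \<subseteq> B \<times> B" using eq by (auto simp: equiv_def)
  have "(f a, f b) \<in> pull_rel A g r \<squnion>\<^sub>r pull_rel A g s" if "(a, b) \<in> r \<squnion>\<^sub>r s" for a b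
    using that
  proof induction
    case (base b)
    then show ?case using sub f by (intro r_into_trancl) auto
  next
    case (step b c)
    then have "(f b, f c) \<in> pull_rel A g r \<union> pull_rel A g s" using sub f by auto
    then show ?case by (rule trancl_into_trancl[OF step.IH])
  qed
  then have "(f (g x), f (g y)) \<in> pull_rel A g r \<squnion>\<^sub>r pull_rel A g s"
    if "(g x, g y) \<in> r \<squnion>\<^sub>r s" for x y using that .
  then show "pull_rel A g (r \<squnion>\<^sub>r s) \<subseteq> pull_rel A g r \<squnion>\<^sub>r pull_rel A g s"
    by (intro subrelI) (metis fg pull_rel_iff)
qed

definition pull_part :: "'a set \<Rightarrow> ('a \<Rightarrow> 'b) \<Rightarrow> ('b \<times> 'b) set \<Rightarrow> 'a set set" where
  "pull_part A g r = A // pull_rel A g r"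

lemma pull_part:
  assumes "g ` A \<subseteq> B" "equiv B r"
  shows part_rel_pull_part: "part_rel (pull_part A g r) = pull_rel A g r"
    and partition_on_pull_part: "partition_on A (pull_part A g r)"
  unfolding pull_part_def
  using equiv_pull_rel[OF assms] by (rule part_rel_quotient, rule partition_on_quotient)

lemma pair_rel_mod: "pair_rel N (i mod 2) = pair_rel N i"
  by (simp add: pair_rel_def)

lemma equiv_pair_rel: "equiv {..<N} (pair_rel N i)"
  and equiv_parity_rel: "equiv {..<N} (parity_rel N)"
  and equiv_corner_rel: "equiv {..<N} (corner_rel N l W)"
  unfolding pair_rel_def parity_rel_def corner_rel_def by (rule equiv_ker_on)+

text \<open>For a sublattice \<open>S\<close> containing the quadruple, the index relations whose
  pulled-back partitions lie in \<open>S\<close> form a \<open>zigzag_sublattice\<close>. It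
  contains both end atoms, hence all equivalence relations, and each partition of \<open>A\<close>
  comes from one through the inverse of \<open>g\<close>.\<close>

lemma generating_zigzag:
  assumes g: "bij_betw g A {..<N}" and l: "1 \<le> l" and W: "W \<subseteq> {2 * l + 3..<N}" and N: "2 * l + 2 < N"
  shows "generating_set (PLat A) {pull_part A g (corner_rel N l W), pull_part A g (pair_rel N 0),
    pull_part A g (pair_rel N 1), pull_part A g (parity_rel N)}" (is "generating_set _ ?X")
proof -
  have gA: "g ` A \<subseteq> {..<N}" using g by (simp add: bij_betw_def)
  note part = pull_part[OF gA]
  have "?X \<subseteq> carrier (PLat A)"
    by (simp add: PLat_def part equiv_pair_rel equiv_parity_rel equiv_corner_rel)
  moreover have "S = carrier (PLat A)" if S: "sublattice (PLat A) S" "?X \<subseteq> S" for S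
  proof -
    define C where "C = {r. equiv {..<N} r \<and> pull_part A g r \<in> S}"
    interpret zigzag_sublattice N C
    proof
      fix r s assume "r \<in> C" "s \<in> C"
      then have rs: "equiv {..<N} r" "equiv {..<N} s" "pull_part A g r \<in> S" "pull_part A g s \<in> S"
        by (auto simp: C_def)
      then have "pull_part A g r \<sqinter>\<^bsub>PLat A\<^esub> pull_part A g s \<in> S"
          "pull_part A g r \<squnion>\<^bsub>PLat A\<^esub> pull_part A g s \<in> S"
        using S(1) by (auto simp: sublattice_def)
      moreover have "pull_rel A g r \<inter> pull_rel A g s = pull_rel A g (r \<inter> s)" by auto
      ultimately have "pull_part A g (r \<inter> s) \<in> S" "pull_part A g (r \<squnion>\<^sub>r s) \<in> S"
        using rs pull_rel_join[OF g rs(1,2)]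
        by (simp_all add: PLat_meet PLat_join part) (simp_all add: pull_part_def)
      then show "r \<inter> s \<in> C" "r \<squnion>\<^sub>r s \<in> C"
        using rs by (auto simp: C_def intro: equiv_Int equiv_join_rel)
    next
      fix i :: nat
      have "i mod 2 = 0 \<or> i mod 2 = 1" by auto
      then have "pull_part A g (pair_rel N (i mod 2)) \<in> S" using S(2) by auto
      then show "pair_rel N i \<in> C" by (simp add: C_def pair_rel_mod equiv_pair_rel)
    next
      show "parity_rel N \<in> C" using S(2) by (simp add: C_def equiv_parity_rel)
    qed (simp add: C_def)
    have "corner_rel N l W \<in> C" using S(2) by (simp add: C_def equiv_corner_rel)
    note end_atoms = end_atoms_mem[OF this l W N]
    have "P \<in> S" if "P \<in> carrier (PLat A)" for P
    proof -
      have P: "partition_on A P" using that by (simp add: PLat_def)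
      define f where "f = the_inv_into A g"
      have f: "f ` {..<N} \<subseteq> A" and fg: "\<And>x. x \<in> A \<Longrightarrow> f (g x) = x"
        using g unfolding f_def bij_betw_def by (auto intro: the_inv_into_into the_inv_into_f_f)
      define r where "r = pull_rel {..<N} f (part_rel P)"
      have "equiv {..<N} r"
        unfolding r_def using f equiv_part_rel[OF P] by (rule equiv_pull_rel)
      then have "r \<in> C" "equiv {..<N} r"
        using all_mem_of_end_atoms[of "2 * l + 1" r] end_atoms l N by simp_all
      moreover have "pull_rel A g r = part_rel P"
        using equiv_part_rel[OF P] gA fg unfolding r_def equiv_def pull_rel_def by auto
      then have "pull_part A g r = P"
        by (metis P \<open>equiv {..<N} r\<close> part part_rel_inject)
      ultimately show ?thesis by (simp add: C_def)
    qed
    then show ?thesis using S(1) by (auto simp: sublattice_def)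
  qed
  ultimately show ?thesis unfolding generating_set_def by blast
qed

section \<open>Extensions and the recovery of labellings\<close>

lemma part_extends_pull_part:
  assumes "g ` A \<subseteq> B" "equiv B r" "g' ` A' \<subseteq> B'" "equiv B' r'" "A \<subseteq> A'"
    and "\<And>x y. x \<in> A \<Longrightarrow> y \<in> A \<Longrightarrow> (g x, g y) \<in> r \<longleftrightarrow> (g' x, g' y) \<in> r'"
  shows "part_extends A (pull_part A g r) (pull_part A' g' r')"
  using assms by (auto simp: part_extends_def part_block_def part_rel_pull_part)

lemma part_extends_unique:
  assumes "partition_on A P" "partition_on A P'" "part_extends A P Q" "part_extends A P' Q"
  shows "P = P'"
proof (rule part_rel_inject)
  have "part_rel P `` {u} = part_rel P' `` {u}" for u
  proof (cases "u \<in> A")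
    case True
    then show ?thesis using assms(3,4) by (simp add: part_extends_def part_block_def)
  next
    case False
    then show ?thesis using assms(1,2)[THEN equiv_part_rel] by (auto simp: equiv_def)
  qed
  then show "part_rel P = part_rel P'" by auto
qed (use assms in auto)

text \<open>A member of the unordered set reveals its position in the list, because its restriction
  to \<open>A\<close> is exactly one of the distinct \<open>Ps\<close>.\<close>

lemma part_extends_quadruple_unique:
  assumes "distinct Ps" "distinct Qs" "length Ps = length Qs" "length Qs = length Qs'"
    and P: "\<And>i. i < length Ps \<Longrightarrow> partition_on A (Ps ! i)"
    and Q: "\<And>i. i < length Ps \<Longrightarrow> part_extends A (Ps ! i) (Qs ! i)"
    and Q': "\<And>i. i < length Ps \<Longrightarrow> part_extends A (Ps ! i) (Qs' ! i)"
    and eq: "set Qs = set Qs'"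
  shows "Qs = Qs'"
proof (rule nth_equalityI)
  fix i assume i: "i < length Qs"
  then have "Qs ! i \<in> set Qs'" using eq by (metis nth_mem)
  then obtain j where j: "j < length Qs'" "Qs' ! j = Qs ! i" by (auto simp: in_set_conv_nth)
  have "part_extends A (Ps ! j) (Qs ! i)"
    using Q'[of j] j assms(3,4) by simp
  then have "Ps ! i = Ps ! j"
    using P[of i] P[of j] Q[of i] i j assms(3,4) by (intro part_extends_unique[of A _ _ "Qs ! i"]) simp_all
  then have "i = j" using assms(1,3,4) i j by (simp add: nth_eq_iff_index_eq)
  then show "Qs ! i = Qs' ! i" using j by simp
qed (use assms in simp)

text \<open>Labels propagate along the path: the only partner of \<open>i\<close> in
  \<open>pair_rel N i\<close> other than itself is \<open>i + 1\<close>, and injectivity of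
  \<open>g'\<close> excludes \<open>i\<close>.\<close>

lemma zigzag_labelling_unique:
  assumes g: "bij_betw g A {..<N}" and g': "bij_betw g' A {..<N}" and "0 < n"
    and agree: "\<And>x. x \<in> A \<Longrightarrow> g x < n \<Longrightarrow> g' x = g x"
    and pair: "\<And>i. i < 2 \<Longrightarrow> pull_rel A g (pair_rel N i) = pull_rel A g' (pair_rel N i)"
  shows "x \<in> A \<Longrightarrow> g' x = g x"
proof (induction "g x" arbitrary: x rule: less_induct)
  case less
  show ?case
  proof (cases "g x < n")
    case False
    then obtain i where i: "g x = Suc i" using \<open>0 < n\<close> by (cases "g x") auto
    have lt: "Suc i < N" using g less.prems i by (metis bij_betwE lessThan_iff)
    have "i \<in> g ` A" using g lt by (simp add: bij_betw_def)
    then obtain z where z: "z \<in> A" "g z = i" by auto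
    then have z': "g' z = i" using less.hyps[of z] i by simp
    have "(z, x) \<in> pull_rel A g (pair_rel N (i mod 2))"
      using z less.prems i lt by (simp add: pair_rel_mod) (simp add: pair_rel_iff)
    then have "(z, x) \<in> pull_rel A g' (pair_rel N (i mod 2))" using pair[of "i mod 2"] by simp
    then have "(i, g' x) \<in> pair_rel N i" using z' by (simp add: pair_rel_mod)
    moreover have "g' x \<noteq> i"
    proof
      assume "g' x = i"
      then have "x = z" using z z' g' less.prems by (metis bij_betw_inv_into_left)
      then show False using z i by simp
    qed
    ultimately show ?thesis using i by (auto simp: pair_rel_iff mod2_eq_if split: if_splits)
  qed (use agree less.prems in auto)
qed

text \<open>An atom is determined by its two-element block, so that block receives the labels 0 and
  \<open>2 * l + 1\<close> and any bijection labels the rest.\<close>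

lemma part_atom_labelling:
  assumes atom: "part_atom {1..n} \<alpha>" and n: "n = 2 * l + 3"
  obtains g where "bij_betw g {1..n} {..<n}" "\<alpha> = pull_part {1..n} g (corner_rel n l {})"
proof -
  obtain B where P: "partition_on {1..n} \<alpha>" and B: "B \<in> \<alpha>" "card B = 2"
    and sing: "\<And>C. C \<in> \<alpha> \<Longrightarrow> C \<noteq> B \<Longrightarrow> is_singleton C"
    using atom by (auto simp: part_atom_def)
  obtain p q where pq: "B = {p, q}" "p \<noteq> q" using B(2) by (auto simp: card_2_iff)
  have BA: "B \<subseteq> {1..n}" using P B(1) by (auto simp: partition_on_def)
  have "card ({1..n} - B) = card ({..<n} - {0, 2 * l + 1})"
    using BA B(2) n card_Diff_subset[of B "{1..n}"] card_Diff_subset[of "{0, 2 * l + 1}" "{..<n}"]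
    by (simp add: pq)
  then obtain h where h: "bij_betw h ({1..n} - B) ({..<n} - {0, 2 * l + 1})"
    using finite_same_card_bij[of "{1..n} - B" "{..<n} - {0, 2 * l + 1}"] by auto
  define g where "g x = (if x = p then 0 else if x = q then 2 * l + 1 else h x)" for x
  have gB: "bij_betw g B {0, 2 * l + 1}"
    using pq by (auto simp: g_def bij_betw_def)
  have gC: "bij_betw g ({1..n} - B) ({..<n} - {0, 2 * l + 1})"
    using h by (rule bij_betw_cong[THEN iffD1, rotated]) (auto simp: g_def pq)
  from bij_betw_combine[OF gC gB]
  have "bij_betw g ({1..n} - B \<union> B) ({..<n} - {0, 2 * l + 1} \<union> {0, 2 * l + 1})" by auto
  moreover have "{1..n} - B \<union> B = {1..n}" "{..<n} - {0, 2 * l + 1} \<union> {0, 2 * l + 1} = {..<n}"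
    using BA n by auto
  ultimately have g: "bij_betw g {1..n} {..<n}" by simp
  then have gA: "g ` {1..n} \<subseteq> {..<n}" and inj: "inj_on g {1..n}" by (auto simp: bij_betw_def)
  have rel: "(x, y) \<in> part_rel \<alpha> \<longleftrightarrow> x \<in> {1..n} \<and> y \<in> {1..n} \<and> (x = y \<or> x \<in> B \<and> y \<in> B)" for x y
  proof -
    have "\<Union>\<alpha> = {1..n}" using P by (simp add: partition_on_def)
    moreover have "x = y" if "C \<in> \<alpha>" "C \<noteq> B" "x \<in> C" "y \<in> C" for C
      using sing[OF that(1,2)] that(3,4) by (auto simp: is_singleton_def)
    ultimately show ?thesis using B(1) by (auto simp: part_rel_def)
  qed
  have iff: "z \<in> B \<longleftrightarrow> g z \<in> {0, 2 * l + 1}" if "z \<in> {1..n}" for z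
    using bij_betwE[OF gB] bij_betwE[OF gC] that by blast
  have "part_rel \<alpha> = pull_rel {1..n} g (corner_rel n l {})"
  proof (intro equalityI subrelI)
    fix x y
    have "(x, y) \<in> part_rel \<alpha> \<longleftrightarrow> (x, y) \<in> pull_rel {1..n} g (corner_rel n l {})"
    proof (cases "x \<in> {1..n} \<and> y \<in> {1..n}")
      case True
      then have "g x < n" "g y < n" and eq: "g x = g y \<longleftrightarrow> x = y"
        using bij_betwE[OF g] inj_on_eq_iff[OF inj] by blast+
      moreover have "x \<in> B \<longleftrightarrow> g x \<in> {0, 2 * l + 1}" "y \<in> B \<longleftrightarrow> g y \<in> {0, 2 * l + 1}"
        using True iff by blast+
      ultimately show ?thesis
        using True unfolding rel pull_rel_iff corner_rel_iff[OF empty_subsetI] by blast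
    next
      case False
      then show ?thesis unfolding rel pull_rel_iff by blast
    qed
    then show "(x, y) \<in> part_rel \<alpha> \<Longrightarrow> (x, y) \<in> pull_rel {1..n} g (corner_rel n l {})"
      "(x, y) \<in> pull_rel {1..n} g (corner_rel n l {}) \<Longrightarrow> (x, y) \<in> part_rel \<alpha>" by simp_all
  qed
  then have "\<alpha> = pull_part {1..n} g (corner_rel n l {})"
    using pull_part[OF gA equiv_corner_rel] by (intro part_rel_inject[OF P]) auto
  then show ?thesis using that g by blast
qed

section \<open>The quadruples and their extensions\<close>

text \<open>A list keeps the order of the four partitions, which must match up under
  extension.\<close>

definition zigzag_parts :: "'a set \<Rightarrow> ('a \<Rightarrow> nat) \<Rightarrow> nat \<Rightarrow> nat \<Rightarrow> nat set \<Rightarrow> 'a set set list" where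
  "zigzag_parts A g N l W = map (pull_part A g)
     [corner_rel N l W, pair_rel N 0, pair_rel N 1, parity_rel N]"

text \<open>The permutation \<open>p\<close> arranges the new elements
  \<open>n + 1, ..., n + m\<close>; subtracting 1 turns these into the indices
  \<open>n, ..., n + m - 1\<close>.\<close>

definition extended_labelling :: "nat \<Rightarrow> (nat \<Rightarrow> nat) \<Rightarrow> (nat \<Rightarrow> nat) \<Rightarrow> nat \<Rightarrow> nat" where
  "extended_labelling n g p x = (if x \<le> n then g x else p x - 1)"

lemma bij_betw_extended_labelling:
  assumes g: "bij_betw g {1..n} {..<n}" and p: "p permutes {n + 1..n + m}"
  shows "bij_betw (extended_labelling n g p) {1..n + m} {..<n + m}"
proof -
  have "bij_betw (\<lambda>x. x - 1) {n + 1..n + m} {n..<n + m}"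
    by (rule bij_betw_byWitness[where f' = Suc]) auto
  from bij_betw_trans[OF permutes_imp_bij[OF p] this]
  have "bij_betw (extended_labelling n g p) {n + 1..n + m} {n..<n + m}"
    by (rule bij_betw_cong[THEN iffD1, rotated]) (auto simp: extended_labelling_def)
  moreover have "bij_betw (extended_labelling n g p) {1..n} {..<n}"
    using g by (rule bij_betw_cong[THEN iffD1, rotated]) (auto simp: extended_labelling_def)
  ultimately have "bij_betw (extended_labelling n g p) ({1..n} \<union> {n + 1..n + m}) ({..<n} \<union> {n..<n + m})"
    by (intro bij_betw_combine) auto
  moreover have "{1..n} \<union> {n + 1..n + m} = {1..n + m}" "{..<n} \<union> {n..<n + m} = {..<n + m}"
    by auto
  ultimately show ?thesis by simp
qed

lemma partition_on_zigzag_parts: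
  assumes "bij_betw g A {..<N}" "P \<in> set (zigzag_parts A g N l W)"
  shows "partition_on A P"
  using assms partition_on_pull_part[of g A "{..<N}"]
  by (auto simp: zigzag_parts_def bij_betw_def equiv_corner_rel equiv_pair_rel equiv_parity_rel)

lemma distinct_zigzag_rels:
  assumes "1 \<le> l" "2 * l + 2 < N" "W \<subseteq> {2 * l + 3..<N}"
  shows "distinct [corner_rel N l W, pair_rel N 0, pair_rel N 1, parity_rel N]"
proof -
  have "(0, 1) \<in> pair_rel N 0" "(0, 1) \<notin> pair_rel N 1" "(0, 1) \<notin> parity_rel N"
    "(0, 1) \<notin> corner_rel N l W" "(1, 2) \<in> pair_rel N 1" "(1, 2) \<notin> parity_rel N"
    "(1, 2) \<notin> corner_rel N l W" "(0, 2) \<in> parity_rel N" "(0, 2) \<notin> corner_rel N l W"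
    using assms by (auto simp: pair_rel_iff corner_rel_iff[OF assms(3)])
  then show ?thesis by (auto simp del: parity_rel_iff)
qed

lemma pull_rel_inject:
  assumes g: "bij_betw g A B" and "equiv B r" "equiv B s" "pull_rel A g r = pull_rel A g s"
  shows "r = s"
proof -
  have "(x, y) \<in> r \<longleftrightarrow> (x, y) \<in> s" if xy: "x \<in> B" "y \<in> B" for x y
  proof -
    obtain a b where "a \<in> A" "b \<in> A" "g a = x" "g b = y"
      using g xy by (auto simp: bij_betw_def)
    then show ?thesis using assms(4) pull_rel_iff by metis
  qed
  moreover have "r \<subseteq> B \<times> B" "s \<subseteq> B \<times> B" using assms(2,3) by (auto simp: equiv_def)
  ultimately show ?thesis by auto
qed

lemma pull_part_eqD:
  assumes "g ` A \<subseteq> B" "g' ` A \<subseteq> B'" "equiv B r" "equiv B' r'" "pull_part A g r = pull_part A g' r'"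
  shows "pull_rel A g r = pull_rel A g' r'"
  using part_rel_pull_part[OF assms(1,3)] part_rel_pull_part[OF assms(2,4)] assms(5) by simp

lemma distinct_zigzag_parts:
  assumes g: "bij_betw g A {..<N}" and "1 \<le> l" "2 * l + 2 < N" "W \<subseteq> {2 * l + 3..<N}"
  shows "distinct (zigzag_parts A g N l W)"
proof -
  let ?R = "[corner_rel N l W, pair_rel N 0, pair_rel N 1, parity_rel N]"
  have eq: "equiv {..<N} r" if "r \<in> set ?R" for r
    using that by (auto simp: equiv_corner_rel equiv_pair_rel equiv_parity_rel)
  have "g ` A \<subseteq> {..<N}" using g by (simp add: bij_betw_def)
  then have "inj_on (pull_part A g) (set ?R)"
    using pull_rel_inject[OF g eq eq] eq by (intro inj_onI) (metis part_rel_pull_part)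
  then show ?thesis
    unfolding zigzag_parts_def distinct_map using distinct_zigzag_rels assms(2-) by blast
qed

text \<open>Below \<open>n\<close> the four relations do not change when the bound grows from
  \<open>n\<close> to \<open>n + m\<close>, since \<open>W\<close> contains new indices
  only.\<close>

lemma zigzag_parts_extend:
  assumes g: "bij_betw g {1..n} {..<n}" and p: "p permutes {n + 1..n + m}"
    and n: "n = 2 * l + 3" and W: "W \<subseteq> {n..<n + m}" and i: "i < 4"
  shows "part_extends {1..n} (zigzag_parts {1..n} g n l {} ! i)
    (zigzag_parts {1..n + m} (extended_labelling n g p) (n + m) l W ! i)"
proof -
  let ?g = "extended_labelling n g p"
  have gA: "g ` {1..n} \<subseteq> {..<n}" "?g ` {1..n + m} \<subseteq> {..<n + m}"
    using g bij_betw_extended_labelling[OF g p] by (auto simp: bij_betw_def)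
  have ext: "part_extends {1..n} (pull_part {1..n} g r) (pull_part {1..n + m} ?g r')"
    if "equiv {..<n} r" "equiv {..<n + m} r'"
      "\<And>a b. a < n \<Longrightarrow> b < n \<Longrightarrow> (a, b) \<in> r \<longleftrightarrow> (a, b) \<in> r'" for r r'
  proof (rule part_extends_pull_part[OF gA(1) that(1) gA(2) that(2)])
    fix x y assume "x \<in> {1..n}" "y \<in> {1..n}"
    then have "g x < n" "g y < n" "?g x = g x" "?g y = g y"
      using bij_betwE[OF g] by (simp_all add: extended_labelling_def)
    then show "(g x, g y) \<in> r \<longleftrightarrow> (?g x, ?g y) \<in> r'" using that(3) by simp
  qed simp
  have W': "W \<subseteq> {2 * l + 3..<n + m}" "a \<notin> W" if "a < n" for a
    using W n that by auto
  have "i = 0 \<or> i = 1 \<or> i = 2 \<or> i = 3" using i by auto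
  moreover have "part_extends {1..n} (pull_part {1..n} g (corner_rel n l {}))
      (pull_part {1..n + m} ?g (corner_rel (n + m) l W))"
    using W' n by (intro ext equiv_corner_rel) (auto simp: corner_rel_iff)
  moreover have "part_extends {1..n} (pull_part {1..n} g (pair_rel n j))
      (pull_part {1..n + m} ?g (pair_rel (n + m) j))" for j
    by (intro ext equiv_pair_rel) (auto simp: pair_rel_iff)
  moreover have "part_extends {1..n} (pull_part {1..n} g (parity_rel n))
      (pull_part {1..n + m} ?g (parity_rel (n + m)))"
    by (intro ext equiv_parity_rel) auto
  ultimately show ?thesis by (auto simp: zigzag_parts_def)
qed

text \<open>Every index has the parity of \<open>N - 1\<close> or of \<open>N - 2\<close>, so with both of these in the set the
  other elements of the set can be read off.\<close>

lemma corner_rel_recover: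
  assumes "V \<subseteq> {2 * l + 3..<N - 2}" "2 * l + 5 \<le> N"
  shows "V = {i \<in> {2 * l + 3..<N - 2}. (i, N - 1) \<in> corner_rel N l (V \<union> {N - 2, N - 1}) \<or>
    (i, N - 2) \<in> corner_rel N l (V \<union> {N - 2, N - 1})}"
proof -
  have "V \<subseteq> {2 * l + 3..<N}" using assms(1) by (rule subset_trans) auto
  then have W: "V \<union> {N - 2, N - 1} \<subseteq> {2 * l + 3..<N}" using assms(2) by (simp, linarith)
  have "N - 1 = Suc (N - 2)" using assms(2) by simp
  then have par: "i mod 2 = (N - 1) mod 2 \<or> i mod 2 = (N - 2) mod 2" for i
    by (auto simp: mod2_eq_if)
  have "(i, N - 1) \<in> corner_rel N l (V \<union> {N - 2, N - 1}) \<or>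
    (i, N - 2) \<in> corner_rel N l (V \<union> {N - 2, N - 1}) \<longleftrightarrow> i \<in> V"
    if "i \<in> {2 * l + 3..<N - 2}" for i
  proof -
    have "i \<notin> {0, 2 * l + 1}" "i \<noteq> N - 1" "i \<noteq> N - 2" "i < N" "N - 1 < N" "N - 2 < N"
      using that assms(2) by auto
    then show ?thesis
      using par[of i] unfolding corner_rel_iff[OF W] by blast
  qed
  then show ?thesis using assms(1) by blast
qed

text \<open>Restriction to the old elements recovers the order of the quadruple, the two pairings
  then recover \<open>p\<close>, and the first partition recovers \<open>V\<close>.\<close>

lemma zigzag_parts_inject:
  assumes g: "bij_betw g {1..n} {..<n}" and n: "n = 2 * l + 3" "1 \<le> l" and m: "2 \<le> m"
    and p: "p permutes {n + 1..n + m}" "V \<subseteq> {n..<n + m - 2}"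
    and p': "p' permutes {n + 1..n + m}" "V' \<subseteq> {n..<n + m - 2}"
    and eq: "set (zigzag_parts {1..n + m} (extended_labelling n g p) (n + m) l
          (V \<union> {n + m - 2, n + m - 1}))
      = set (zigzag_parts {1..n + m} (extended_labelling n g p') (n + m) l
          (V' \<union> {n + m - 2, n + m - 1}))"
  shows "p = p' \<and> V = V'"
proof -
  let ?A = "{1..n + m}" and ?N = "n + m"
  let ?g = "extended_labelling n g p" and ?g' = "extended_labelling n g p'"
  let ?W = "V \<union> {n + m - 2, n + m - 1}" and ?W' = "V' \<union> {n + m - 2, n + m - 1}"
  have "U \<union> {n + m - 2, n + m - 1} \<subseteq> {n..<n + m}" if "U \<subseteq> {n..<n + m - 2}" for U
    using subset_trans[OF that, of "{n..<n + m}"] m by auto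
  from this[OF p(2)] this[OF p'(2)] have W: "?W \<subseteq> {n..<n + m}" "?W' \<subseteq> {n..<n + m}" .
  have bij: "bij_betw ?g ?A {..<?N}" "bij_betw ?g' ?A {..<?N}"
    using bij_betw_extended_labelling g p p' by blast+
  then have img: "?g ` ?A \<subseteq> {..<?N}" "?g' ` ?A \<subseteq> {..<?N}" by (auto simp: bij_betw_def)
  have "zigzag_parts ?A ?g ?N l ?W = zigzag_parts ?A ?g' ?N l ?W'"
  proof (rule part_extends_quadruple_unique)
    let ?Ps = "zigzag_parts {1..n} g n l {}"
    show "distinct ?Ps" using distinct_zigzag_parts[OF g] n by simp
    show "distinct (zigzag_parts ?A ?g ?N l ?W)"
      using distinct_zigzag_parts[OF bij(1)] n W by simp
    have len: "length (zigzag_parts B h M k U) = 4" for B :: "nat set" and h M k U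
      by (simp add: zigzag_parts_def)
    then show "length ?Ps = length (zigzag_parts ?A ?g ?N l ?W)"
      "length (zigzag_parts ?A ?g ?N l ?W) = length (zigzag_parts ?A ?g' ?N l ?W')" by simp_all
    fix i assume "i < length ?Ps"
    then show "partition_on {1..n} (?Ps ! i)"
      "part_extends {1..n} (?Ps ! i) (zigzag_parts ?A ?g ?N l ?W ! i)"
      "part_extends {1..n} (?Ps ! i) (zigzag_parts ?A ?g' ?N l ?W' ! i)"
      using partition_on_zigzag_parts[OF g nth_mem] zigzag_parts_extend[OF g p(1) n(1) W(1)]
        zigzag_parts_extend[OF g p'(1) n(1) W(2)] by (simp_all add: len)
  qed (rule eq)
  then have "pull_part ?A ?g (corner_rel ?N l ?W) = pull_part ?A ?g' (corner_rel ?N l ?W')"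
    "pull_part ?A ?g (pair_rel ?N 0) = pull_part ?A ?g' (pair_rel ?N 0)"
    "pull_part ?A ?g (pair_rel ?N 1) = pull_part ?A ?g' (pair_rel ?N 1)"
    by (simp_all only: zigzag_parts_def list.map list.inject)
  note corner = pull_part_eqD[OF img equiv_corner_rel equiv_corner_rel this(1)]
    and pair = this(2,3)[THEN pull_part_eqD[OF img equiv_pair_rel equiv_pair_rel]]
  have same: "?g' x = ?g x" if "x \<in> ?A" for x
  proof (rule zigzag_labelling_unique[OF bij(1) bij(2), of n])
    show "?g' y = ?g y" if "y \<in> ?A" "?g y < n" for y
    proof -
      have "y \<le> n"
      proof (rule ccontr)
        assume "\<not> y \<le> n"
        then have "y \<in> {n + 1..n + m}" using that by simp
        then have "p y \<in> {n + 1..n + m}" using p(1) by (metis permutes_in_image)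
        then have "n \<le> p y - 1" by auto
        then show False using that(2) \<open>\<not> y \<le> n\<close> by (simp add: extended_labelling_def)
      qed
      then show ?thesis by (simp add: extended_labelling_def)
    qed
    show "pull_rel ?A ?g (pair_rel ?N i) = pull_rel ?A ?g' (pair_rel ?N i)" if "i < 2" for i
      using that pair by (auto simp: less_2_cases_iff)
  qed (use n that in auto)
  have "p x = p' x" for x
  proof (cases "x \<in> {n + 1..n + m}")
    case True
    then have "p x \<in> {n + 1..n + m}" "p' x \<in> {n + 1..n + m}"
      using p(1) p'(1) by (metis permutes_in_image)+
    moreover have "p' x - 1 = p x - 1" using same[of x] True by (simp add: extended_labelling_def)
    \<comment> \<open>Both values are positive, so the truncated subtraction can be
      cancelled.\<close>
    ultimately show ?thesis by (cases "p x"; cases "p' x") auto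
  next
    case False
    then show ?thesis using p(1) p'(1) by (metis permutes_not_in)
  qed
  then have pp: "p = p'" by auto
  have corner': "corner_rel ?N l ?W = corner_rel ?N l ?W'"
    by (rule pull_rel_inject[OF bij(1) equiv_corner_rel equiv_corner_rel corner[folded pp]])
  let ?S = "\<lambda>R. {i \<in> {2 * l + 3..<?N - 2}. (i, ?N - 1) \<in> R \<or> (i, ?N - 2) \<in> R}"
  have "V = ?S (corner_rel ?N l ?W)"
    using p(2) n m by (intro corner_rel_recover) auto
  also have "\<dots> = ?S (corner_rel ?N l ?W')" by (simp only: corner')
  also have "\<dots> = V'"
    using p'(2) n m by (intro corner_rel_recover[symmetric]) auto
  finally show ?thesis using pp by simp
qed

section \<open>Counting the extensions\<close>

lemma powi_fact_bound:
  assumes "2 \<le> m"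
  shows "2 powi (int m - 3) * fact (m - 1) / (3 * real m + 3) \<le> real (fact m * 2 ^ (m - 2))"
proof -
  obtain j where j: "m = Suc (Suc j)" using assms by (metis add_2_eq_Suc le_add_diff_inverse)
  \<comment> \<open>The exponent \<open>j - 1\<close> is -1 for \<open>m = 2\<close>, so the power
    is rewritten as \<open>2 ^ j / 2\<close>.\<close>
  have "(2::real) powi (int m - 3) = 2 powi (int j - 1)" by (simp add: j)
  also have "\<dots> = 2 ^ j / 2" by (simp add: power_int_diff)
  finally have "2 powi (int m - 3) * fact (m - 1) / (3 * real m + 3)
      = 2 ^ j / 2 * fact (m - 1) / (3 * real m + 3)" by (simp only:)
  also have "\<dots> \<le> 2 ^ j / 2 * fact (m - 1) / 1"
    by (rule divide_left_mono) auto
  also have "\<dots> \<le> 2 ^ j * fact m"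
    unfolding div_by_1 using fact_mono[of "m - 1" m, where 'a = real] by (intro mult_mono) simp_all
  also have "\<dots> = real (fact m * 2 ^ (m - 2))"
  proof -
    have "m - 2 = j" by (simp add: j)
    then show ?thesis by (simp add: mult.commute)
  qed
  finally show ?thesis .
qed

theorem corollary2p3:
  fixes m n :: nat and \<alpha> :: "nat set set"
  assumes "m > 0" and "even m"
    and "n \<ge> 5" and "odd n"
    and "part_atom {1..n} \<alpha>"
  shows "\<exists>\<beta> \<gamma> \<delta>.
    \<beta> \<in> carrier (PLat {1..n}) \<and> \<gamma> \<in> carrier (PLat {1..n}) \<and> \<delta> \<in> carrier (PLat {1..n}) \<and>
    card {\<alpha>, \<beta>, \<gamma>, \<delta>} = 4 \<and> generating_set (PLat {1..n}) {\<alpha>, \<beta>, \<gamma>, \<delta>} \<and>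
    real (card {X. \<exists>\<alpha>' \<beta>' \<gamma>' \<delta>'. X = {\<alpha>', \<beta>', \<gamma>', \<delta>'} \<and> card X = 4 \<and>
        generating_set (PLat {1..n + m}) X \<and>
        part_extends {1..n} \<alpha> \<alpha>' \<and> part_extends {1..n} \<beta> \<beta>' \<and>
        part_extends {1..n} \<gamma> \<gamma>' \<and> part_extends {1..n} \<delta> \<delta>'})
      \<ge> 2 powi (int m - 3) * fact (m - 1) / (3 * real m + 3)"
proof -
  obtain k where k: "n = 2 * k + 1" using \<open>odd n\<close> by (auto elim: oddE)
  \<comment> \<open>Then \<open>n - 2 = 2 * l + 1\<close> is the second index of the atom's block,
    and \<open>n >= 5\<close> becomes \<open>1 <= l\<close>.\<close>
  define l where "l = k - 1"
  have n: "n = 2 * l + 3" and l: "1 \<le> l" using k \<open>n \<ge> 5\<close> by (auto simp: l_def)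
  have m: "2 \<le> m" using \<open>m > 0\<close> \<open>even m\<close> by (cases "m = 1") auto
  obtain g where g: "bij_betw g {1..n} {..<n}" and \<alpha>: "\<alpha> = pull_part {1..n} g (corner_rel n l {})"
    using part_atom_labelling[OF assms(5) n] by blast
  define \<beta> \<gamma> \<delta> where "\<beta> = pull_part {1..n} g (pair_rel n 0)"
    and "\<gamma> = pull_part {1..n} g (pair_rel n 1)" and "\<delta> = pull_part {1..n} g (parity_rel n)"
  have Ps: "zigzag_parts {1..n} g n l {} = [\<alpha>, \<beta>, \<gamma>, \<delta>]"
    by (simp add: zigzag_parts_def \<alpha> \<beta>_def \<gamma>_def \<delta>_def)
  have gen: "generating_set (PLat {1..n}) {\<alpha>, \<beta>, \<gamma>, \<delta>}"
    unfolding \<alpha> \<beta>_def \<gamma>_def \<delta>_def by (rule generating_zigzag[OF g l]) (use n in auto)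
  have "distinct [\<alpha>, \<beta>, \<gamma>, \<delta>]"
    using distinct_zigzag_parts[OF g l, of "{}"] n unfolding Ps by simp
  then have card4: "card {\<alpha>, \<beta>, \<gamma>, \<delta>} = 4" using distinct_card by fastforce
  let ?G = "{X. \<exists>\<alpha>' \<beta>' \<gamma>' \<delta>'. X = {\<alpha>', \<beta>', \<gamma>', \<delta>'} \<and> card X = 4 \<and>
        generating_set (PLat {1..n + m}) X \<and>
        part_extends {1..n} \<alpha> \<alpha>' \<and> part_extends {1..n} \<beta> \<beta>' \<and>
        part_extends {1..n} \<gamma> \<gamma>' \<and> part_extends {1..n} \<delta> \<delta>'}"
  \<comment> \<open>Each parameter consists of an arrangement of the new elements and a choice of
    \<open>W\<close> apart from its two fixed last indices.\<close>
  let ?D = "{p. p permutes {n + 1..n + m}} \<times> Pow {n..<n + m - 2}"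
  let ?W = "\<lambda>V. V \<union> {n + m - 2, n + m - 1}"
  let ?Q = "\<lambda>(p, V). zigzag_parts {1..n + m} (extended_labelling n g p) (n + m) l (?W V)"
  have "?G \<subseteq> Pow (carrier (PLat {1..n + m}))"
    by (auto simp: generating_set_def)
  moreover have "carrier (PLat {1..n + m}) \<subseteq> Pow (Pow {1..n + m})"
  proof
    fix P assume "P \<in> carrier (PLat {1..n + m})"
    then have "\<Union>P = {1..n + m}" by (simp add: PLat_simps partition_on_def)
    then show "P \<in> Pow (Pow {1..n + m})" by blast
  qed
  \<comment> \<open>An infinite set would have \<open>card\<close> 0, so the comparison of
    cardinalities relies on finiteness.\<close>
  ultimately have fin: "finite ?G"
    by (meson finite_Pow_iff finite_atLeastAtMost finite_subset)
  have "inj_on (set \<circ> ?Q) ?D"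
  proof (rule inj_onI, clarsimp)
    fix p V p' V'
    assume "p permutes {Suc n..n + m}" "V \<subseteq> {n..<n + m - 2}"
      "p' permutes {Suc n..n + m}" "V' \<subseteq> {n..<n + m - 2}"
      "set (zigzag_parts {Suc 0..n + m} (extended_labelling n g p) (n + m) l
         (insert (n + m - 2) (insert (n + m - Suc 0) V))) =
       set (zigzag_parts {Suc 0..n + m} (extended_labelling n g p') (n + m) l
         (insert (n + m - 2) (insert (n + m - Suc 0) V')))"
    then show "p = p' \<and> V = V'"
      using zigzag_parts_inject[OF g n l m, of p V p' V'] by simp
  qed
  moreover have "(set \<circ> ?Q) ` ?D \<subseteq> ?G"
  proof (rule image_subsetI, unfold mem_Collect_eq)
    fix d assume "d \<in> ?D"
    then obtain p V where d: "d = (p, V)" and p: "p permutes {n + 1..n + m}"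
      and V: "V \<subseteq> {n..<n + m - 2}" by blast
    let ?g = "extended_labelling n g p" and ?N = "n + m" and ?A = "{1..n + m}"
    have W: "?W V \<subseteq> {n..<n + m}"
      using subset_trans[OF V, of "{n..<n + m}"] m by auto
    have bij: "bij_betw ?g ?A {..<?N}" by (rule bij_betw_extended_labelling[OF g p])
    let ?a = "pull_part ?A ?g (corner_rel ?N l (?W V))" and ?b = "pull_part ?A ?g (pair_rel ?N 0)"
      and ?c = "pull_part ?A ?g (pair_rel ?N 1)" and ?d = "pull_part ?A ?g (parity_rel ?N)"
    have Q: "zigzag_parts ?A ?g ?N l (?W V) = [?a, ?b, ?c, ?d]"
      by (simp add: zigzag_parts_def)
    then have X: "(set \<circ> ?Q) d = {?a, ?b, ?c, ?d}" by (simp add: d)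
    have "distinct [?a, ?b, ?c, ?d]"
      using distinct_zigzag_parts[OF bij l, of "?W V"] n W unfolding Q by simp
    then have "card (set [?a, ?b, ?c, ?d]) = 4" by (subst distinct_card) simp_all
    then have "card {?a, ?b, ?c, ?d} = 4" by simp
    moreover have "generating_set (PLat ?A) {?a, ?b, ?c, ?d}"
      by (rule generating_zigzag[OF bij l]) (use n W in auto)
    moreover have "part_extends {1..n} ([\<alpha>, \<beta>, \<gamma>, \<delta>] ! i) ([?a, ?b, ?c, ?d] ! i)" if "i < 4" for i
      using zigzag_parts_extend[OF g p n W that] unfolding Ps Q .
    from this[of 0] this[of 1] this[of 2] this[of 3]
    have "part_extends {1..n} \<alpha> ?a" "part_extends {1..n} \<beta> ?b" "part_extends {1..n} \<gamma> ?c"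
      "part_extends {1..n} \<delta> ?d" by simp_all
    ultimately show "\<exists>\<alpha>' \<beta>' \<gamma>' \<delta>'. (set \<circ> ?Q) d = {\<alpha>', \<beta>', \<gamma>', \<delta>'} \<and>
        card ((set \<circ> ?Q) d) = 4 \<and> generating_set (PLat {1..n + m}) ((set \<circ> ?Q) d) \<and>
        part_extends {1..n} \<alpha> \<alpha>' \<and> part_extends {1..n} \<beta> \<beta>' \<and>
        part_extends {1..n} \<gamma> \<gamma>' \<and> part_extends {1..n} \<delta> \<delta>'"
      unfolding X by blast
  qed
  ultimately have "card ?D \<le> card ?G" using fin by (rule card_inj_on_le)
  moreover have "card ?D = fact m * 2 ^ (m - 2)"
    using m by (simp add: card_cartesian_product card_permutations[OF refl] card_Pow)
  ultimately have "real (card ?G) \<ge> 2 powi (int m - 3) * fact (m - 1) / (3 * real m + 3)"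
    using powi_fact_bound[OF m] by linarith
  moreover have "\<beta> \<in> carrier (PLat {1..n})" "\<gamma> \<in> carrier (PLat {1..n})" "\<delta> \<in> carrier (PLat {1..n})"
    using gen by (auto simp: generating_set_def)
  ultimately show ?thesis using card4 gen by blast
qed

end
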